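(* Let $a<0$ and consider the system $\dot x=ax+yz,\ \dot y=ay+xz,\ \dot z=z-xy$ on $\mathbb{R}^3$. It possesses exactly five fixed points, namely the origin and $$(\sqrt{-a},\sqrt{-a},-a),\quad(-\sqrt{-a},-\sqrt{-a},-a),\quad(-\sqrt{-a},\sqrt{-a},a),\quad(\sqrt{-a},-\sqrt{-a},a),$$ all of which are hyperbolic saddles. There exist four heteroclinic orbits, connecting each one of the four non-trivial equilibria with the origin, contained in the invariant planes $x=y$ and $x=-y$. All other orbits tend to these two planes for $t\to+\infty$.
   Context: A heteroclinic orbit connecting two distinct equilibria is an orbit tending to one of them as $t\to-\infty$ and to the other as $t\to+\infty$. An orbit tends to the two planes if its distance to the union $\{x=y\}\cup\{x=-y\}$ tends to $0$. *)

theory Defs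
  imports "HOL-Analysis.Analysis"
begin

text \<open>Solutions of the autonomous equation \<open>\<phi>' = f \<phi>\<close> on an open time interval \<open>T\<close>. An orbit is
  the trace of a solution that admits no proper extension, so completeness of the
  system is not built in.\<close>

definition solution_on :: "('a::real_normed_vector \<Rightarrow> 'a) \<Rightarrow> real set \<Rightarrow> (real \<Rightarrow> 'a) \<Rightarrow> bool" where
  "solution_on f T \<phi> \<longleftrightarrow> open T \<and> is_interval T \<and> T \<noteq> {} \<and>
     (\<forall>t\<in>T. (\<phi> has_vector_derivative f (\<phi> t)) (at t))"

definition maximal_solution :: "('a::real_normed_vector \<Rightarrow> 'a) \<Rightarrow> real set \<Rightarrow> (real \<Rightarrow> 'a) \<Rightarrow> bool" where
  "maximal_solution f T \<phi> \<longleftrightarrow> solution_on f T \<phi> \<and>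
     (\<forall>T' \<psi>. solution_on f T' \<psi> \<and> T \<subseteq> T' \<and> (\<forall>t\<in>T. \<psi> t = \<phi> t) \<longrightarrow> T' = T)"

definition equilibria :: "('a::real_normed_vector \<Rightarrow> 'a) \<Rightarrow> 'a set" where
  "equilibria f = {p. f p = 0}"

definition invariant_set :: "('a::real_normed_vector \<Rightarrow> 'a) \<Rightarrow> 'a set \<Rightarrow> bool" where
  "invariant_set f S \<longleftrightarrow>
     (\<forall>T \<phi>. solution_on f T \<phi> \<and> (\<exists>t\<in>T. \<phi> t \<in> S) \<longrightarrow> \<phi> ` T \<subseteq> S)"

definition complex_eigenvalues :: "real^'n^'n \<Rightarrow> complex set" where
  "complex_eigenvalues A =
     {\<mu>. \<exists>v::complex^'n. v \<noteq> 0 \<and> (\<chi> i j. complex_of_real (A $ i $ j)) *v v = \<mu> *s v}"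

definition hyperbolic_saddle :: "(real^'n \<Rightarrow> real^'n) \<Rightarrow> real^'n \<Rightarrow> bool" where
  "hyperbolic_saddle f p \<longleftrightarrow> p \<in> equilibria f \<and> f differentiable (at p) \<and>
     (\<forall>\<mu>\<in>complex_eigenvalues (jacobian f (at p)). Re \<mu> \<noteq> 0) \<and>
     (\<exists>\<mu>\<in>complex_eigenvalues (jacobian f (at p)). Re \<mu> < 0) \<and>
     (\<exists>\<mu>\<in>complex_eigenvalues (jacobian f (at p)). Re \<mu> > 0)"

text \<open>A connection between \<open>p\<close> and \<open>q\<close> may run in either direction. Its two limits force the
  time interval to be the whole line, so the solution is automatically maximal.\<close>

definition heteroclinic_orbit ::
    "('a::real_normed_vector \<Rightarrow> 'a) \<Rightarrow> 'a \<Rightarrow> 'a \<Rightarrow> 'a set \<Rightarrow> bool" where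
  "heteroclinic_orbit f p q \<gamma> \<longleftrightarrow> p \<in> equilibria f \<and> q \<in> equilibria f \<and> p \<noteq> q \<and>
     (\<exists>\<phi>. solution_on f UNIV \<phi> \<and> \<gamma> = range \<phi> \<and>
        ((\<phi> \<longlongrightarrow> p) at_bot \<and> (\<phi> \<longlongrightarrow> q) at_top \<or>
         (\<phi> \<longlongrightarrow> q) at_bot \<and> (\<phi> \<longlongrightarrow> p) at_top))"

text \<open>The limit \<open>t \<rightarrow> \<infinity>\<close> only makes sense if the solution exists for all large times,
  which is therefore part of the property.\<close>

definition tends_to_set :: "real set \<Rightarrow> (real \<Rightarrow> 'a::metric_space) \<Rightarrow> 'a set \<Rightarrow> bool" where
  "tends_to_set T \<phi> S \<longleftrightarrow>
     (\<exists>t0. {t0..} \<subseteq> T) \<and> ((\<lambda>t. infdist (\<phi> t) S) \<longlongrightarrow> 0) at_top"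

definition vfield :: "real \<Rightarrow> real^3 \<Rightarrow> real^3" where
  "vfield a v = vector [a * v$1 + v$2 * v$3, a * v$2 + v$1 * v$3, v$3 - v$1 * v$2]"

definition plane_pos :: "(real^3) set" where
  "plane_pos = {v. v$1 = v$2}"

definition plane_neg :: "(real^3) set" where
  "plane_neg = {v. v$1 = - v$2}"

definition nontrivial_equilibria :: "real \<Rightarrow> (real^3) set" where
  "nontrivial_equilibria a =
     {vector [sqrt (-a), sqrt (-a), -a], vector [- sqrt (-a), - sqrt (-a), -a],
      vector [- sqrt (-a), sqrt (-a), a], vector [sqrt (-a), - sqrt (-a), a]}"

end

theory Submission
  imports Defs
begin

text \<open>Along every solution \<open>(x + y) * (x - y)\<close> satisfies the linear equation \<open>w' = 2 * a * w\<close>, so it decays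
  and one of the two factors becomes small; solutions exist for all forward time because
  \<open>x\<^sup>2 + y\<^sup>2 + 2 * z\<^sup>2\<close> grows at most like \<open>exp (2 * t)\<close>.

  With \<open>b = -a\<close>, the dynamics on the plane \<open>x = y\<close> is \<open>x' = (z - b) * x\<close>, \<open>z' = z - x\<^sup>2\<close>; the substitution
  \<open>x = exp w\<close> turns it into \<open>w'' - w' = b - exp (2 * w)\<close>, an oscillator in a coercive potential
  that is damped in reversed time. The stable branch of the origin is given by a convergent
  power series in \<open>exp (- 2 * b * t)\<close>; followed backwards, its energy decreases and a strict Lyapunov
  function drives it to the nontrivial equilibrium. The other three connections are the images of
  this one under sign changes.\<close>

section \<open>Equilibria and eigenvalues\<close>

text \<open>The connection has to be selected at the origin: within its plane the nontrivial
  equilibrium is a source, whereas the origin has eigenvalues -b and 1 there, hence a stable curve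
  with one branch for each sign of x. The planar system is symmetric under x -> -x, which suggests
  expanding x^2 and z, rather than x, in powers of exp (-2 b t). The energy level of this branch
  does double duty. It bounds the solution uniformly at all earlier times, so that backward
  continuation proceeds in steps of fixed length; and it confines x between two positive constants,
  so that the Lyapunov estimates hold with uniform constants. The same estimates cover all values of
  a, although the source is a node or a spiral according to the sign of 1 + 8 a.\<close>

lemma vfield_nth [simp]:
  "vfield a v $ 1 = a * v$1 + v$2 * v$3"
  "vfield a v $ 2 = a * v$2 + v$1 * v$3"
  "vfield a v $ 3 = v$3 - v$1 * v$2"
  by (simp_all add: vfield_def)

lemma vec3_eq_iff: "(v::'a^3) = w \<longleftrightarrow> v$1 = w$1 \<and> v$2 = w$2 \<and> v$3 = w$3"
  by (simp add: vec_eq_iff forall_3)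

text \<open>Eliminating z = x y leaves x (a + y^2) = 0 and y (a + x^2) = 0. Since a is nonzero, x
  and y vanish together; otherwise both squares equal -a and the signs are free.\<close>

lemma equilibria_vfield:
  assumes "a < 0"
  shows "equilibria (vfield a) = insert 0 (nontrivial_equilibria a)"
proof (intro set_eqI iffI)
  fix p :: "real^3"
  assume "p \<in> equilibria (vfield a)"
  then have 1: "a * p$1 + p$2 * p$3 = 0" and 2: "a * p$2 + p$1 * p$3 = 0" and 3: "p$3 = p$1 * p$2"
    by (auto simp: equilibria_def vec3_eq_iff)
  have x: "p$1 * (a + p$2^2) = 0" using 1 3 by algebra
  have y: "p$2 * (a + p$1^2) = 0" using 2 3 by algebra
  show "p \<in> insert 0 (nontrivial_equilibria a)"
  proof (cases "p$1 = 0 \<or> p$2 = 0")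
    case True
    then have "p = 0" using x y 3 assms by (auto simp: vec3_eq_iff)
    then show ?thesis by simp
  next
    case False
    then have "p$1^2 = -a" "p$2^2 = -a" using x y by auto
    moreover have "w = sqrt (-a) \<or> w = - sqrt (-a)" if "w^2 = -a" for w :: real
      using that by (metis abs_real_def minus_minus real_sqrt_abs)
    ultimately have "p$1 = sqrt (-a) \<or> p$1 = - sqrt (-a)" "p$2 = sqrt (-a) \<or> p$2 = - sqrt (-a)"
      by auto
    moreover have "sqrt (-a) * sqrt (-a) = -a" using assms by simp
    ultimately show ?thesis using 3
      by (auto simp: nontrivial_equilibria_def vec3_eq_iff)
  qed
next
  fix p :: "real^3"
  assume "p \<in> insert 0 (nontrivial_equilibria a)"
  moreover have "sqrt (-a) * sqrt (-a) = -a" using assms by simp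
  ultimately show "p \<in> equilibria (vfield a)"
    by (auto simp: equilibria_def nontrivial_equilibria_def vec3_eq_iff)
qed

lemma card_equilibria_vfield:
  assumes "a < 0"
  shows "card (equilibria (vfield a)) = 5"
proof -
  have "sqrt (-a) > 0" using assms by simp
  then show ?thesis
    by (simp add: equilibria_vfield[OF assms] nontrivial_equilibria_def card_insert_if vec3_eq_iff)
qed

definition vfield_jacobian :: "real \<Rightarrow> real^3 \<Rightarrow> real^3^3" where
  "vfield_jacobian a p = vector [vector [a, p$3, p$2], vector [p$3, a, p$1], vector [- p$2, - p$1, 1]]"

lemma has_derivative_vec3:
  fixes f :: "'a::real_normed_vector \<Rightarrow> real^3"
  assumes "((\<lambda>x. f x $ 1) has_derivative (\<lambda>h. f' h $ 1)) (at x within S)"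
    "((\<lambda>x. f x $ 2) has_derivative (\<lambda>h. f' h $ 2)) (at x within S)"
    "((\<lambda>x. f x $ 3) has_derivative (\<lambda>h. f' h $ 3)) (at x within S)"
  shows "(f has_derivative f') (at x within S)"
proof -
  have "((\<lambda>x. f x \<bullet> axis i 1) has_derivative (\<lambda>h. f' h \<bullet> axis i 1)) (at x within S)" for i
    using assms exhaust_3[of i] by (auto simp: inner_axis)
  then show ?thesis
    unfolding has_derivative_componentwise_within[of f f' x S] by (auto simp: Basis_vec_def)
qed

lemma has_derivative_vfield:
  "(vfield a has_derivative (\<lambda>h. vfield_jacobian a p *v h)) (at p)"
proof -
  note [derivative_intros] = bounded_linear.has_derivative[OF bounded_linear_vec_nth]
  have "(vfield_jacobian a p *v h) $ 1 = a * h$1 + p$3 * h$2 + p$2 * h$3"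
    "(vfield_jacobian a p *v h) $ 2 = p$3 * h$1 + a * h$2 + p$1 * h$3"
    "(vfield_jacobian a p *v h) $ 3 = - p$2 * h$1 - p$1 * h$2 + h$3" for h
    by (simp_all add: vfield_jacobian_def matrix_vector_mult_def sum_3)
  then show ?thesis
    by (intro has_derivative_vec3)
      (simp_all only: vfield_nth, (rule derivative_eq_intros refl | simp add: fun_eq_iff algebra_simps)+)
qed

lemma jacobian_vfield: "jacobian (vfield a) (at p) = vfield_jacobian a p"
  by (simp add: jacobian_def frechet_derivative_at[OF has_derivative_vfield, symmetric])

text \<open>With eigenvectors written as triples of scalars, the spectra are found by combining
  three linear equations; no characteristic polynomial of a 3 x 3 matrix is formed.\<close>

lemma complex_eigenvalues_vfield:
  fixes \<mu> :: complex
  shows "\<mu> \<in> complex_eigenvalues (jacobian (vfield a) (at p)) \<longleftrightarrow>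
    (\<exists>u v w :: complex. (u \<noteq> 0 \<or> v \<noteq> 0 \<or> w \<noteq> 0) \<and> of_real a * u + of_real (p$3) * v + of_real (p$2) * w = \<mu> * u \<and>
      of_real (p$3) * u + of_real a * v + of_real (p$1) * w = \<mu> * v \<and> - of_real (p$2) * u - of_real (p$1) * v + w = \<mu> * w)"
    (is "_ = (\<exists>u v w. ?P u v w)")
proof -
  have "\<mu> \<in> complex_eigenvalues (jacobian (vfield a) (at p)) \<longleftrightarrow> (\<exists>v::complex^3. ?P (v$1) (v$2) (v$3))"
    by (simp add: complex_eigenvalues_def jacobian_vfield vec3_eq_iff vfield_jacobian_def
        matrix_vector_mult_def sum_3)
  also have "\<dots> \<longleftrightarrow> (\<exists>u v w. ?P u v w)"
  proof
    assume "\<exists>u v w. ?P u v w"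
    then obtain u v w where "?P u v w" by blast
    then show "\<exists>v::complex^3. ?P (v$1) (v$2) (v$3)"
      by (intro exI[of _ "vector [u, v, w]"]) (simp only: vector_3)
  qed blast
  finally show ?thesis .
qed

lemma hyperbolic_saddle_origin:
  assumes "a < 0"
  shows "hyperbolic_saddle (vfield a) 0"
proof -
  have "\<mu> \<in> complex_eigenvalues (jacobian (vfield a) (at 0)) \<longleftrightarrow> \<mu> = of_real a \<or> \<mu> = 1" for \<mu>
    unfolding complex_eigenvalues_vfield by auto
  moreover have "vfield a differentiable at 0"
    using has_derivative_vfield differentiable_def by blast
  moreover have "0 \<in> equilibria (vfield a)" by (simp add: equilibria_vfield[OF assms])
  ultimately show ?thesis using assms unfolding hyperbolic_saddle_def
    by (intro conjI ballI bexI[of _ 1] bexI[of _ "of_real a"]) auto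
qed

text \<open>The roots have sum 1 and product \<open>c\<close>: a real root equals its square plus
  \<open>c\<close>, and a non-real one has real part 1/2.\<close>

lemma Re_pos_of_quadratic:
  fixes \<mu> :: complex
  assumes "\<mu>^2 - \<mu> + of_real c = 0" "c > 0"
  shows "Re \<mu> > 0"
proof -
  have "(Re \<mu>)^2 - (Im \<mu>)^2 - Re \<mu> + c = 0" "Im \<mu> * (2 * Re \<mu> - 1) = 0"
    using assms(1) by (simp_all add: complex_eq_iff power2_eq_square algebra_simps)
  then consider "Re \<mu> = (Re \<mu>)\<^sup>2 + c" | "Re \<mu> = 1 / 2"
    by (cases "Im \<mu> = 0") simp_all
  then show ?thesis
    using assms(2) by cases (metis add_nonneg_pos zero_le_power2, simp)
qed

text \<open>The coordinates d = u - s v and e = u + s v decouple the Jacobian: d is multiplied by 2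
  a, while (e, w) is mapped to (2 s x w, w - s x e). As x^2 = -a, this block has the characteristic
  equation \<mu>^2 - \<mu> - 2 a = 0, whose roots have positive real part.\<close>

lemma hyperbolic_saddle_nontrivial:
  assumes "a < 0" "s = 1 \<or> s = -1" "x\<^sup>2 = -a" "p = vector [x, s * x, s * (-a)]"
  shows "hyperbolic_saddle (vfield a) p"
proof -
  define E where "E = complex_eigenvalues (jacobian (vfield a) (at p))"
  have p [simp]: "p$1 = x" "p$2 = s * x" "p$3 = - (s * a)" by (simp_all add: assms(4))
  have ss: "s * s = 1" using assms(2) by auto
  have cx: "complex_of_real x * of_real x = - of_real a"
    using assms(3) by (simp flip: of_real_mult add: power2_eq_square)
  have cs: "complex_of_real s * of_real s = 1" using ss by (simp flip: of_real_mult)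
  have cases: "\<mu> = 2 * of_real a \<or> Re \<mu> > 0" if "\<mu> \<in> E" for \<mu>
  proof -
    obtain u v w where nz: "u \<noteq> 0 \<or> v \<noteq> 0 \<or> w \<noteq> 0"
      and 1: "of_real a * u + of_real (p$3) * v + of_real (p$2) * w = \<mu> * u" and 2: "of_real (p$3) * u + of_real a * v + of_real (p$1) * w = \<mu> * v"
      and 3: "- of_real (p$2) * u - of_real (p$1) * v + w = \<mu> * w"
      using \<open>\<mu> \<in> E\<close> unfolding complex_eigenvalues_vfield E_def by blast
    define d e where "d = u - s * v" and "e = u + s * v"
    have d: "2 * of_real a * d = \<mu> * d"
      using 1 2 cs unfolding d_def p of_real_mult of_real_minus by algebra
    have e: "2 * of_real s * of_real x * w = \<mu> * e"
      using 1 2 cs unfolding e_def p of_real_mult of_real_minus by algebra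
    have w: "- of_real s * of_real x * e + w = \<mu> * w"
      using 3 cs unfolding e_def p of_real_mult of_real_minus by algebra
    show ?thesis
    proof (cases "d = 0")
      case False then show ?thesis using d by auto
    next
      case True
      have "x \<noteq> 0" "s \<noteq> 0" using assms by auto
      have "w \<noteq> 0"
      proof
        assume "w = 0"
        then have "e = 0" using w \<open>x \<noteq> 0\<close> \<open>s \<noteq> 0\<close> by simp
        with True have "u = 0" "s * v = 0" by (auto simp: d_def e_def)
        then show False using nz \<open>w = 0\<close> \<open>s \<noteq> 0\<close> by simp
      qed
      have "w * (\<mu>^2 - \<mu> - 2 * of_real a) = 0"
        using e w cx cs by algebra
      then have "\<mu>^2 - \<mu> + of_real (-2 * a) = 0" using \<open>w \<noteq> 0\<close> by simp
      then show ?thesis using Re_pos_of_quadratic[of \<mu> "-2 * a"] assms(1) by auto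
    qed
  qed
  have "2 * of_real a \<in> E" unfolding E_def complex_eigenvalues_vfield p
    by (rule exI[of _ 1], rule exI[of _ "- of_real s"], rule exI[of _ 0]) (use ss cs in \<open>simp add: algebra_simps\<close>)
  \<comment> \<open>A root from the quadratic formula; \<open>csqrt\<close> is used because 1 + 8 a
    may be negative. The eigenvector given below for it is (s x, x, \<mu>).\<close>
  moreover define \<mu> where "\<mu> = (1 + csqrt (1 + 8 * of_real a)) / 2"
  have "\<mu>^2 - \<mu> - 2 * of_real a = 0"
    using power2_csqrt[of "1 + 8 * of_real a"] unfolding \<mu>_def by (simp add: power2_eq_square field_simps)
  then have mu: "\<mu> * \<mu> = \<mu> + 2 * of_real a" by (simp add: power2_eq_square algebra_simps)
  have "\<mu> \<noteq> 0" using mu assms(1) by auto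
  have "\<mu> \<in> E" unfolding E_def complex_eigenvalues_vfield p
  proof (intro exI conjI)
    show "of_real (s * x) \<noteq> 0 \<or> of_real x \<noteq> (0::complex) \<or> \<mu> \<noteq> 0" using \<open>\<mu> \<noteq> 0\<close> by simp
    show "of_real a * of_real (s * x) + of_real (- (s * a)) * of_real x + of_real (s * x) * \<mu> = \<mu> * of_real (s * x)"
      by simp
    show "of_real (- (s * a)) * of_real (s * x) + of_real a * of_real x + of_real x * \<mu> = \<mu> * of_real x"
      unfolding of_real_mult of_real_minus using cs by algebra
    show "- of_real (s * x) * of_real (s * x) - of_real x * of_real x + \<mu> = \<mu> * \<mu>"
      unfolding of_real_mult of_real_minus using cs cx mu by algebra
  qed
  moreover have "Re \<mu> > 0"
    using Re_pos_of_quadratic[of \<mu> "-2*a"] mu assms(1) by (simp add: power2_eq_square)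
  moreover have "p \<in> equilibria (vfield a)"
    using assms by (auto simp: equilibria_def vec3_eq_iff power2_eq_square)
  moreover have "vfield a differentiable at p"
    using has_derivative_vfield differentiable_def by blast
  ultimately show ?thesis
    unfolding hyperbolic_saddle_def E_def[symmetric] using cases assms(1)
    by (intro conjI ballI bexI[of _ \<mu>] bexI[of _ "2 * of_real a"]) fastforce+
qed

text \<open>Here r is the sign of x and s selects the plane y = s x. The same pairs of signs index
  the symmetries that later produce the four connections.\<close>

lemma nontrivial_equilibria_signs:
  "nontrivial_equilibria a =
    (\<lambda>(r, s). vector [r * sqrt (-a), s * (r * sqrt (-a)), s * (-a)]) ` ({1, -1} \<times> {1, -1})"
  by (auto simp: nontrivial_equilibria_def image_iff)

lemma hyperbolic_saddle_vfield:
  assumes "a < 0" "p \<in> equilibria (vfield a)"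
  shows "hyperbolic_saddle (vfield a) p"
proof -
  consider "p = 0" | r s where "r = 1 \<or> r = -1" "s = 1 \<or> s = -1"
      "p = vector [r * sqrt (-a), s * (r * sqrt (-a)), s * (-a)]"
  proof -
    have "p = 0 \<or> p \<in> nontrivial_equilibria a"
      using assms(2) by (simp add: equilibria_vfield[OF assms(1)])
    then show thesis
      using that unfolding nontrivial_equilibria_signs by (elim disjE imageE) auto
  qed
  then show ?thesis
  proof cases
    case 1 then show ?thesis using hyperbolic_saddle_origin assms(1) by simp
  next
    case 2
    then have "(r * sqrt (-a))\<^sup>2 = -a" using assms(1) by (auto simp: power_mult_distrib)
    then show ?thesis using hyperbolic_saddle_nontrivial[OF assms(1) 2(2) _ 2(3)] by blast
  qed
qed

section \<open>Uniqueness, local existence and continuation\<close>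

lemma has_vector_derivative_vec3:
  fixes \<phi> :: "real \<Rightarrow> real^3"
  shows "(\<phi> has_vector_derivative d) (at t) \<longleftrightarrow>
    ((\<lambda>s. \<phi> s $ 1) has_real_derivative d$1) (at t) \<and>
    ((\<lambda>s. \<phi> s $ 2) has_real_derivative d$2) (at t) \<and>
    ((\<lambda>s. \<phi> s $ 3) has_real_derivative d$3) (at t)" (is "?L \<longleftrightarrow> ?R")
proof
  assume ?L
  then have "((\<lambda>s. \<phi> s $ i) has_real_derivative d$i) (at t)" for i
    using bounded_linear.has_vector_derivative[OF bounded_linear_vec_nth]
    by (auto simp: has_real_derivative_iff_has_vector_derivative)
  then show ?R by blast
next
  assume ?R
  then show ?L
    unfolding has_real_derivative_iff_has_vector_derivative has_vector_derivative_def
    by (intro has_derivative_vec3) (simp_all only: vector_scaleR_component)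
qed

text \<open>Gronwall's argument: the squared norm of \<open>g\<close> times exp (-2 K s) cannot
  increase. It is applied both to differences of solutions and to the linear forms x + y and x -
  y.\<close>

lemma zero_of_linear_growth_right:
  fixes g :: "real \<Rightarrow> 'a::real_inner"
  assumes "t0 \<le> t"
    and g: "\<And>s. t0 \<le> s \<Longrightarrow> s \<le> t \<Longrightarrow> (g has_vector_derivative g' s) (at s)"
    and K: "\<And>s. t0 \<le> s \<Longrightarrow> s \<le> t \<Longrightarrow> norm (g' s) \<le> K * norm (g s)"
    and "g t0 = 0"
  shows "g t = 0"
proof -
  define h where "h s = (g s \<bullet> g s) * exp (- 2 * K * s)" for s
  have "h t \<le> h t0"
  proof (rule DERIV_nonpos_imp_nonincreasing[OF \<open>t0 \<le> t\<close>])
    fix s assume s: "t0 \<le> s" "s \<le> t"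
    have "((\<lambda>s. g s \<bullet> g s) has_real_derivative 2 * (g s \<bullet> g' s)) (at s)"
      using g[OF s] unfolding has_vector_derivative_def has_field_derivative_def
      by (auto intro!: derivative_eq_intros simp: inner_commute)
    then have "(h has_real_derivative (2 * (g s \<bullet> g' s) - 2 * K * (g s \<bullet> g s)) * exp (- 2 * K * s)) (at s)"
      unfolding h_def by (auto intro!: derivative_eq_intros simp: algebra_simps)
    moreover have "g s \<bullet> g' s \<le> K * (g s \<bullet> g s)"
    proof -
      have "g s \<bullet> g' s \<le> norm (g s) * norm (g' s)" by (rule norm_cauchy_schwarz)
      also have "\<dots> \<le> norm (g s) * (K * norm (g s))" by (intro mult_left_mono K s norm_ge_zero)
      finally show ?thesis by (simp add: dot_square_norm power2_eq_square algebra_simps)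
    qed
    ultimately show "\<exists>y. (h has_real_derivative y) (at s) \<and> y \<le> 0"
      by (intro exI conjI) (auto intro!: mult_nonpos_nonneg)
  qed
  then have "g t \<bullet> g t \<le> 0" using \<open>g t0 = 0\<close> by (simp add: h_def mult_le_0_iff)
  then show ?thesis by (metis inner_eq_zero_iff inner_ge_zero order_antisym)
qed

lemma zero_of_linear_growth:
  fixes g :: "real \<Rightarrow> 'a::real_inner"
  assumes g: "\<And>s. s \<in> closed_segment t0 t \<Longrightarrow> (g has_vector_derivative g' s) (at s)"
    and K: "\<And>s. s \<in> closed_segment t0 t \<Longrightarrow> norm (g' s) \<le> K * norm (g s)"
    and "g t0 = 0"
  shows "g t = 0"
proof (cases "t0 \<le> t")
  case True
  then show ?thesis
    using zero_of_linear_growth_right[of t0 t g g' K] assms by (auto simp: closed_segment_eq_real_ivl)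
next
  case False
  define f where "f s = g (- s)" for s
  have "f (-t) = 0"
  proof (rule zero_of_linear_growth_right[of "-t0" "-t" f "\<lambda>s. - g' (-s)" K])
    fix s assume "- t0 \<le> s" "s \<le> -t"
    then have s: "- s \<in> closed_segment t0 t" using False by (simp add: closed_segment_eq_real_ivl)
    have "(g \<circ> uminus has_vector_derivative (-1) *\<^sub>R g' (-s)) (at s)"
      by (rule vector_diff_chain_at) (auto intro!: derivative_eq_intros g[OF s])
    then show "(f has_vector_derivative - g' (-s)) (at s)" by (simp add: f_def[abs_def] o_def)
    show "norm (- g' (-s)) \<le> K * norm (f s)" using K[OF s] by (simp add: f_def)
  qed (use False \<open>g t0 = 0\<close> in \<open>auto simp: f_def\<close>)
  then show ?thesis by (simp add: f_def)
qed

lemma norm_vec3_le: "norm (v::real^3) \<le> \<bar>v$1\<bar> + \<bar>v$2\<bar> + \<bar>v$3\<bar>"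
  using norm_le_l1_cart[of v] by (simp add: sum_3)

text \<open>Each component is a linear term with coefficient at most |a| + 1 plus or minus one
  product; on the ball of radius \<open>R\<close> the difference of two products costs 2 R. The
  factor 3 comes from bounding the norm by the sum of the three components.\<close>

lemma vfield_lipschitz:
  assumes "norm v \<le> R" "norm w \<le> R"
  shows "norm (vfield a v - vfield a w) \<le> 3 * (\<bar>a\<bar> + 1 + 2 * R) * norm (v - w)"
proof -
  have R: "\<bar>v$i\<bar> \<le> R" "\<bar>w$i\<bar> \<le> R" for i
    using assms component_le_norm_cart order_trans by blast+
  then have "R \<ge> 0" by (meson abs_ge_zero order_trans)
  have d: "\<bar>v$i - w$i\<bar> \<le> norm (v - w)" for i
    using component_le_norm_cart[of "v - w" i] by simp
  have prod: "\<bar>v$i * v$j - w$i * w$j\<bar> \<le> 2 * R * norm (v - w)" for i j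
  proof -
    have "v$i * v$j - w$i * w$j = v$i * (v$j - w$j) + (v$i - w$i) * w$j" by (simp add: algebra_simps)
    also have "\<bar>\<dots>\<bar> \<le> \<bar>v$i\<bar> * \<bar>v$j - w$j\<bar> + \<bar>v$i - w$i\<bar> * \<bar>w$j\<bar>"
      by (metis abs_mult abs_triangle_ineq)
    also have "\<dots> \<le> R * norm (v - w) + norm (v - w) * R"
      by (intro add_mono mult_mono R d) (use \<open>R \<ge> 0\<close> in auto)
    finally show ?thesis by simp
  qed
  have lin: "\<bar>c * (v$i - w$i)\<bar> \<le> (\<bar>a\<bar> + 1) * norm (v - w)" if "\<bar>c\<bar> \<le> \<bar>a\<bar> + 1" for c i
    unfolding abs_mult by (intro mult_mono d that) auto
  have "\<bar>vfield a v $ i - vfield a w $ i\<bar> \<le> (\<bar>a\<bar> + 1 + 2 * R) * norm (v - w)" for i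
  proof -
    have "\<bar>vfield a v $ 1 - vfield a w $ 1\<bar> \<le> (\<bar>a\<bar> + 1) * norm (v - w) + 2 * R * norm (v - w)"
      using lin[of a 1] prod[of 2 3] by (simp add: algebra_simps)
    moreover have "\<bar>vfield a v $ 2 - vfield a w $ 2\<bar> \<le> (\<bar>a\<bar> + 1) * norm (v - w) + 2 * R * norm (v - w)"
      using lin[of a 2] prod[of 1 3] by (simp add: algebra_simps)
    moreover have "\<bar>vfield a v $ 3 - vfield a w $ 3\<bar> \<le> (\<bar>a\<bar> + 1) * norm (v - w) + 2 * R * norm (v - w)"
      using lin[of 1 3] prod[of 1 2] by (simp add: algebra_simps)
    ultimately show ?thesis using exhaust_3[of i] by (auto simp: algebra_simps)
  qed
  from this[of 1] this[of 2] this[of 3] show ?thesis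
    using norm_vec3_le[of "vfield a v - vfield a w"]
    unfolding mult.assoc[of 3] vector_minus_component by linarith
qed

lemma solution_bounded_on_segment:
  assumes "solution_on f T \<phi>" "t0 \<in> T" "t \<in> T"
  obtains R where "\<And>s. s \<in> closed_segment t0 t \<Longrightarrow> norm (\<phi> s) \<le> R"
proof -
  have "closed_segment t0 t \<subseteq> T"
    using assms by (auto simp: solution_on_def is_interval_convex_1 closed_segment_subset)
  then have "continuous_on (closed_segment t0 t) \<phi>"
    using assms(1) by (auto simp: solution_on_def intro!: continuous_at_imp_continuous_on
        has_vector_derivative_continuous)
  then have "bounded (\<phi> ` closed_segment t0 t)"
    by (intro compact_imp_bounded compact_continuous_image) auto
  then show ?thesis using that by (auto simp: bounded_iff)
qed

lemma solution_segment_subset: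
  assumes "solution_on f T \<phi>" "t0 \<in> T" "t \<in> T" "s \<in> closed_segment t0 t"
  shows "s \<in> T"
  using assms closed_segment_subset[of t0 T t] by (auto simp: solution_on_def is_interval_convex_1)

lemma solution_unique:
  assumes \<phi>: "solution_on (vfield a) T \<phi>" and \<psi>: "solution_on (vfield a) T \<psi>"
    and "t0 \<in> T" "\<phi> t0 = \<psi> t0" "t \<in> T"
  shows "\<phi> t = \<psi> t"
proof -
  obtain R1 where R1: "\<And>s. s \<in> closed_segment t0 t \<Longrightarrow> norm (\<phi> s) \<le> R1"
    using solution_bounded_on_segment[OF \<phi> \<open>t0 \<in> T\<close> \<open>t \<in> T\<close>] by blast
  obtain R2 where R2: "\<And>s. s \<in> closed_segment t0 t \<Longrightarrow> norm (\<psi> s) \<le> R2"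
    using solution_bounded_on_segment[OF \<psi> \<open>t0 \<in> T\<close> \<open>t \<in> T\<close>] by blast
  define R where "R = max R1 R2"
  have "\<phi> t - \<psi> t = 0"
  proof (rule zero_of_linear_growth[where g = "\<lambda>s. \<phi> s - \<psi> s"
        and g' = "\<lambda>s. vfield a (\<phi> s) - vfield a (\<psi> s)" and ?t0.0 = t0])
    fix s assume s: "s \<in> closed_segment t0 t"
    then have "s \<in> T" using solution_segment_subset[OF \<phi>] assms by blast
    then show "((\<lambda>s. \<phi> s - \<psi> s) has_vector_derivative vfield a (\<phi> s) - vfield a (\<psi> s)) (at s)"
      using \<phi> \<psi> by (auto simp: solution_on_def intro!: has_vector_derivative_diff)
    show "norm (vfield a (\<phi> s) - vfield a (\<psi> s)) \<le> 3 * (\<bar>a\<bar> + 1 + 2 * R) * norm (\<phi> s - \<psi> s)"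
      using R1[OF s] R2[OF s] by (intro vfield_lipschitz) (auto simp: R_def)
  qed (use assms in auto)
  then show ?thesis by simp
qed

lemma solution_derivs:
  assumes "solution_on (vfield a) T \<phi>" "t \<in> T"
  shows "((\<lambda>s. \<phi> s $ 1) has_real_derivative a * \<phi> t $ 1 + \<phi> t $ 2 * \<phi> t $ 3) (at t)"
    "((\<lambda>s. \<phi> s $ 2) has_real_derivative a * \<phi> t $ 2 + \<phi> t $ 1 * \<phi> t $ 3) (at t)"
    "((\<lambda>s. \<phi> s $ 3) has_real_derivative \<phi> t $ 3 - \<phi> t $ 1 * \<phi> t $ 2) (at t)"
  using assms by (auto simp: solution_on_def has_vector_derivative_vec3)

text \<open>The form x + \<sigma> y satisfies a homogeneous linear equation with coefficient a +
  \<sigma> z, which is bounded on compact time segments. The sign \<sigma> = -1 belongs to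
  \<open>plane_pos\<close>, \<sigma> = 1 to \<open>plane_neg\<close>.\<close>

lemma planes_zero_invariant:
  assumes \<phi>: "solution_on (vfield a) T \<phi>" and "\<sigma> = 1 \<or> \<sigma> = -1"
    and "t0 \<in> T" "\<phi> t0 $ 1 + \<sigma> * \<phi> t0 $ 2 = 0" "t \<in> T"
  shows "\<phi> t $ 1 + \<sigma> * \<phi> t $ 2 = 0"
proof -
  obtain R where R: "\<And>s. s \<in> closed_segment t0 t \<Longrightarrow> norm (\<phi> s) \<le> R"
    using solution_bounded_on_segment[OF \<phi> \<open>t0 \<in> T\<close> \<open>t \<in> T\<close>] by blast
  show ?thesis
  proof (rule zero_of_linear_growth[where g = "\<lambda>s. \<phi> s $ 1 + \<sigma> * \<phi> s $ 2"
        and g' = "\<lambda>s. (a + \<sigma> * \<phi> s $ 3) * (\<phi> s $ 1 + \<sigma> * \<phi> s $ 2)" and ?t0.0 = t0 and K = "\<bar>a\<bar> + R"])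
    fix s assume s: "s \<in> closed_segment t0 t"
    then have "s \<in> T" using solution_segment_subset[OF \<phi>] assms by blast
    note d = solution_derivs[OF \<phi> this]
    have "((\<lambda>s. \<phi> s $ 1 + \<sigma> * \<phi> s $ 2) has_real_derivative
        (a * \<phi> s $ 1 + \<phi> s $ 2 * \<phi> s $ 3) + \<sigma> * (a * \<phi> s $ 2 + \<phi> s $ 1 * \<phi> s $ 3)) (at s)"
      by (intro DERIV_add DERIV_cmult d)
    also have "(a * \<phi> s $ 1 + \<phi> s $ 2 * \<phi> s $ 3) + \<sigma> * (a * \<phi> s $ 2 + \<phi> s $ 1 * \<phi> s $ 3)
       = (a + \<sigma> * \<phi> s $ 3) * (\<phi> s $ 1 + \<sigma> * \<phi> s $ 2)"
      using assms(2) by (auto simp: algebra_simps)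
    finally show "((\<lambda>s. \<phi> s $ 1 + \<sigma> * \<phi> s $ 2) has_vector_derivative
        (a + \<sigma> * \<phi> s $ 3) * (\<phi> s $ 1 + \<sigma> * \<phi> s $ 2)) (at s)"
      by (simp add: has_real_derivative_iff_has_vector_derivative)
    have "\<bar>\<phi> s $ 3\<bar> \<le> R" using R[OF s] component_le_norm_cart order_trans by blast
    then have "\<bar>a + \<sigma> * \<phi> s $ 3\<bar> \<le> \<bar>a\<bar> + R" using assms(2) by auto
    then show "norm ((a + \<sigma> * \<phi> s $ 3) * (\<phi> s $ 1 + \<sigma> * \<phi> s $ 2)) \<le> (\<bar>a\<bar> + R) * norm (\<phi> s $ 1 + \<sigma> * \<phi> s $ 2)"
      by (simp add: abs_mult mult_right_mono)
  qed (use assms in auto)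
qed

lemma invariant_planes: "invariant_set (vfield a) plane_pos" "invariant_set (vfield a) plane_neg"
proof -
  show "invariant_set (vfield a) plane_pos"
    unfolding invariant_set_def plane_pos_def
    using planes_zero_invariant[of a _ _ "-1"] by (auto simp: image_subset_iff)
  show "invariant_set (vfield a) plane_neg"
    unfolding invariant_set_def plane_neg_def
    using planes_zero_invariant[of a _ _ 1] by (auto simp: image_subset_iff eq_neg_iff_add_eq_0)
qed

section \<open>Local existence by power series\<close>

lemma fps_conv_radius_ge_of_geometric_bound:
  fixes f :: "'a::{banach, real_normed_div_algebra} fps"
  assumes "\<And>n. norm (fps_nth f n) \<le> C * M ^ n" "M > 0"
  shows "fps_conv_radius f \<ge> ereal (1 / M)"
  unfolding fps_conv_radius_def
proof (rule conv_radius_geI_ex')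
  fix r :: real assume r: "0 < r" "ereal r < ereal (1 / M)"
  then have "M * r < 1" using \<open>M > 0\<close> by (simp add: field_simps)
  then have "summable (\<lambda>n. C * (M * r) ^ n)"
    using r \<open>M > 0\<close> by (intro summable_mult summable_geometric) simp
  then show "summable (\<lambda>n. fps_nth f n * of_real r ^ n)"
  proof (rule summable_comparison_test')
    fix n :: nat
    show "norm (fps_nth f n * of_real r ^ n) \<le> C * (M * r) ^ n"
      using mult_right_mono[OF assms(1)[of n], of "r ^ n"] r
      by (simp add: norm_mult norm_power power_mult_distrib mult.assoc)
  qed
qed

text \<open>Taylor coefficients of the solution starting at \<open>p\<close>. Their geometric bound depends on \<open>norm p\<close>
  only, which yields an existence time that is uniform on balls.\<close>

fun taylor :: "real \<Rightarrow> real^3 \<Rightarrow> nat \<Rightarrow> real^3" where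
  "taylor a p 0 = p"
| "taylor a p (Suc n) = (1 / real (Suc n)) *\<^sub>R vector
    [a * taylor a p n $ 1 + (\<Sum>i\<le>n. taylor a p i $ 2 * taylor a p (n - i) $ 3),
     a * taylor a p n $ 2 + (\<Sum>i\<le>n. taylor a p i $ 1 * taylor a p (n - i) $ 3),
     taylor a p n $ 3 - (\<Sum>i\<le>n. taylor a p i $ 1 * taylor a p (n - i) $ 2)]"

text \<open>A Cauchy product of two geometrically bounded sequences loses only the factor n + 1, the
  number of summands. The division by n + 1 in a power series recursion cancels exactly this factor,
  so the geometric rate survives.\<close>

lemma abs_convolution_le:
  fixes f g :: "nat \<Rightarrow> real"
  assumes "\<And>i. i \<le> n \<Longrightarrow> \<bar>f i\<bar> \<le> A * M ^ i" "\<And>i. i \<le> n \<Longrightarrow> \<bar>g i\<bar> \<le> B * M ^ i" "A \<ge> 0" "M \<ge> 0"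
  shows "\<bar>\<Sum>i\<le>n. f i * g (n - i)\<bar> \<le> real (Suc n) * (A * B * M ^ n)"
proof -
  have "\<bar>f i * g (n - i)\<bar> \<le> A * B * M ^ n" if "i \<in> {..n}" for i
  proof -
    have "\<bar>f i * g (n - i)\<bar> \<le> (A * M ^ i) * (B * M ^ (n - i))"
      unfolding abs_mult using that assms by (intro mult_mono) auto
    also have "\<dots> = A * B * M ^ (i + (n - i))" by (simp only: power_add mult_ac)
    finally show ?thesis using that by simp
  qed
  then have "(\<Sum>i\<le>n. \<bar>f i * g (n - i)\<bar>) \<le> (\<Sum>i\<le>n. A * B * M ^ n)" by (rule sum_mono)
  then show ?thesis
    using order_trans[OF sum_abs] by simp
qed

text \<open>The rate M = |a| + 1 + R makes the induction close: the linear part contributes (|a| +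
  1) R M^m, the quadratic part R R M^m, and together they give R M^(m+1).\<close>

lemma abs_taylor_le:
  assumes "norm p \<le> R"
  shows "\<bar>taylor a p n $ k\<bar> \<le> R * (\<bar>a\<bar> + 1 + R) ^ n"
proof (induction n arbitrary: k rule: less_induct)
  case (less n)
  define M where "M = \<bar>a\<bar> + 1 + R"
  have "R \<ge> 0" using assms norm_ge_zero order_trans by blast
  then have M: "M \<ge> 0" by (simp add: M_def)
  show ?case
  proof (cases n)
    case 0
    then show ?thesis using assms component_le_norm_cart[of p k] by simp
  next
    case (Suc m)
    have IH: "\<bar>taylor a p i $ k\<bar> \<le> R * M ^ i" if "i \<le> m" for i k
      using less[of i k] that Suc by (simp add: M_def)
    have conv: "\<bar>\<Sum>i\<le>m. taylor a p i $ j * taylor a p (m - i) $ l\<bar> \<le> real (Suc m) * (R * R * M ^ m)" for j l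
      by (rule abs_convolution_le) (use IH \<open>R \<ge> 0\<close> M in auto)
    have lin: "\<bar>c * taylor a p m $ j\<bar> \<le> real (Suc m) * ((\<bar>a\<bar> + 1) * (R * M ^ m))" if "\<bar>c\<bar> \<le> \<bar>a\<bar> + 1" for c j
    proof -
      have "\<bar>c * taylor a p m $ j\<bar> \<le> (\<bar>a\<bar> + 1) * (R * M ^ m)"
        unfolding abs_mult using that IH[of m j] by (intro mult_mono) auto
      also have "\<dots> \<le> real (Suc m) * ((\<bar>a\<bar> + 1) * (R * M ^ m))"
        using \<open>R \<ge> 0\<close> M mult_right_mono[of 1 "real (Suc m)" "(\<bar>a\<bar> + 1) * (R * M ^ m)"] by simp
      finally show ?thesis .
    qed
    have total: "real (Suc m) * ((\<bar>a\<bar> + 1) * (R * M ^ m)) + real (Suc m) * (R * R * M ^ m) = real (Suc m) * (R * M ^ n)"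
      by (simp add: Suc M_def algebra_simps)
    have "real (Suc m) * \<bar>taylor a p n $ k\<bar> = \<bar>real (Suc m) * taylor a p n $ k\<bar>" by (simp add: abs_mult)
    also have "\<dots> \<le> real (Suc m) * (R * M ^ n)"
      unfolding total[symmetric]
      using exhaust_3[of k] lin[of a 1] lin[of a 2] lin[of 1 3] conv[of 2 3] conv[of 1 3] conv[of 1 2]
      by (auto simp del: of_nat_Suc simp: Suc
          intro: order_trans[OF abs_triangle_ineq add_mono] order_trans[OF abs_triangle_ineq4 add_mono])
    finally show ?thesis unfolding M_def by (simp del: of_nat_Suc)
  qed
qed

lemma local_solution:
  assumes "norm p \<le> R" "\<delta> = 1 / (\<bar>a\<bar> + 1 + R)"
  obtains \<psi> where "\<psi> t0 = p" "solution_on (vfield a) {t0 - \<delta><..<t0 + \<delta>} \<psi>"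
proof -
  have "R \<ge> 0" using assms norm_ge_zero order_trans by blast
  then have M: "\<bar>a\<bar> + 1 + R > 0" by simp
  define F where "F k = Abs_fps (\<lambda>n. taylor a p n $ k)" for k
  have rad: "ereal \<delta> \<le> fps_conv_radius (F k)" for k
    unfolding assms(2) using M abs_taylor_le[OF assms(1)]
    by (intro fps_conv_radius_ge_of_geometric_bound[where C = R]) (simp_all add: F_def)
  define \<psi> where "\<psi> t = (vector [eval_fps (F 1) (t - t0), eval_fps (F 2) (t - t0), eval_fps (F 3) (t - t0)] :: real^3)" for t
  have F: "fps_nth (F k) n = taylor a p n $ k" for k n by (simp add: F_def)
  have "fps_nth (F j * F k) n = (\<Sum>i\<le>n. taylor a p i $ j * taylor a p (n - i) $ k)" for j k n
    by (simp add: F_def fps_mult_nth atLeast0AtMost)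
  \<comment> \<open>The recursion for \<open>taylor\<close>, read as identities of formal series;
    evaluated inside the radius of convergence they are the differential equations.\<close>
  then have rec: "fps_deriv (F 1) = fps_const a * F 1 + F 2 * F 3"
    "fps_deriv (F 2) = fps_const a * F 2 + F 1 * F 3"
    "fps_deriv (F 3) = F 3 - F 1 * F 2"
    by (simp_all add: F fps_eq_iff)
  have "(\<psi> has_vector_derivative vfield a (\<psi> t)) (at t)" if t: "t \<in> {t0 - \<delta><..<t0 + \<delta>}" for t
  proof -
    define h where "h = t - t0"
    have "norm h < \<delta>" using t by (auto simp: h_def)
    then have h: "ereal (norm h) < fps_conv_radius (F k)" for k
      using rad order_less_le_trans by (metis less_ereal.simps(1))
    have m: "ereal (norm h) < fps_conv_radius (F j * F k)" for j k
      using fps_conv_radius_mult[of "F j" "F k"] h[of j] h[of k] by (meson min_less_iff_conj order_less_le_trans)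
    have c: "ereal (norm h) < fps_conv_radius (fps_const a * F k)" for k
      using fps_conv_radius_mult[of "fps_const a" "F k"] h[of k] by (simp add: order_less_le_trans)
    have d: "((\<lambda>s. eval_fps (F k) (s - t0)) has_real_derivative eval_fps (fps_deriv (F k)) h) (at t)" for k
    proof -
      have "(eval_fps (F k) has_real_derivative eval_fps (fps_deriv (F k)) h) (at (t - t0))"
        unfolding h_def by (rule has_field_derivative_eval_fps) (use h[of k] in \<open>simp add: h_def\<close>)
      moreover have "((\<lambda>s. s - t0) has_real_derivative 1) (at t)"
        by (auto intro!: derivative_eq_intros)
      ultimately show ?thesis
        using DERIV_chain2[where f = "eval_fps (F k)" and g = "\<lambda>s. s - t0" and x = t] by fastforce
    qed
    show ?thesis
      unfolding has_vector_derivative_vec3 \<psi>_def vector_3 vfield_nth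
      using d[of 1] d[of 2] d[of 3] unfolding rec
      by (simp add: eval_fps_add eval_fps_diff eval_fps_mult h[simplified] m[simplified] c[simplified] flip: h_def)
  qed
  then have "solution_on (vfield a) {t0 - \<delta><..<t0 + \<delta>} \<psi>"
    using M by (auto simp: solution_on_def is_interval_convex_1 assms(2))
  moreover have "\<psi> t0 = p"
    by (simp add: \<psi>_def vec3_eq_iff eval_fps_at_0 F_def)
  ultimately show ?thesis by (rule that[rotated])
qed

section \<open>Gluing, forward completeness and approach to the planes\<close>

lemma solution_on_subset:
  assumes "solution_on f T \<phi>" "S \<subseteq> T" "open S" "is_interval S" "S \<noteq> {}"
  shows "solution_on f S \<phi>"
  using assms by (auto simp: solution_on_def)

text \<open>Uniqueness on the overlap makes the two pieces agree there, so near every point the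
  glued function coincides with one of them. The common time \<open>t1\<close> makes the union an
  interval.\<close>

lemma solution_glue:
  assumes \<phi>: "solution_on (vfield a) T \<phi>" and \<psi>: "solution_on (vfield a) S \<psi>"
    and "t1 \<in> T" "t1 \<in> S" "\<phi> t1 = \<psi> t1"
  defines "\<xi> \<equiv> (\<lambda>t. if t \<in> T then \<phi> t else \<psi> t)"
  shows "solution_on (vfield a) (T \<union> S) \<xi>"
proof -
  have TS: "open T" "open S" "is_interval T" "is_interval S"
    using \<phi> \<psi> by (auto simp: solution_on_def)
  have int: "open (T \<inter> S)" "is_interval (T \<inter> S)" "T \<inter> S \<noteq> {}"
    using TS assms by (auto simp: is_interval_Int)
  have eq: "\<phi> t = \<psi> t" if "t \<in> T" "t \<in> S" for t
    using solution_unique[OF solution_on_subset[OF \<phi> _ int] solution_on_subset[OF \<psi> _ int], of t1 t] assms that by auto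
  have "is_interval (T \<union> S)"
    using TS assms unfolding is_interval_connected_1 by (intro connected_Un) auto
  moreover have "(\<xi> has_vector_derivative vfield a (\<xi> t)) (at t)" if "t \<in> T" for t
  proof (rule has_vector_derivative_transform_within_open[OF _ TS(1) that])
    show "(\<phi> has_vector_derivative vfield a (\<xi> t)) (at t)"
      using \<phi> that by (simp add: \<xi>_def solution_on_def)
  qed (simp add: \<xi>_def)
  moreover have "(\<xi> has_vector_derivative vfield a (\<xi> t)) (at t)" if "t \<in> S" for t
  proof (rule has_vector_derivative_transform_within_open[OF _ TS(2) that])
    show "(\<psi> has_vector_derivative vfield a (\<xi> t)) (at t)"
      using \<psi> that eq by (simp add: \<xi>_def solution_on_def)
  qed (simp add: \<xi>_def eq)
  ultimately show ?thesis
    using TS \<open>t1 \<in> T\<close> unfolding solution_on_def by blast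
qed

text \<open>The weights 1, 1, 2 cancel the cubic terms: 2xyz + 2xyz - 4xyz = 0. What remains is W' =
  2 a (x^2 + y^2) + 4 z^2, which is at most 2 W.\<close>

lemma energy_growth:
  assumes \<phi>: "solution_on (vfield a) T \<phi>" and "a < 0" "t0 \<in> T" "t \<in> T" "t0 \<le> t"
  defines "W \<equiv> (\<lambda>v::real^3. (v$1)\<^sup>2 + (v$2)\<^sup>2 + 2 * (v$3)\<^sup>2)"
  shows "W (\<phi> t) \<le> W (\<phi> t0) * exp (2 * (t - t0))"
proof -
  have "W (\<phi> t) * exp (- 2 * t) \<le> W (\<phi> t0) * exp (- 2 * t0)"
  proof (rule DERIV_nonpos_imp_nonincreasing[OF \<open>t0 \<le> t\<close>])
    fix s assume "t0 \<le> s" "s \<le> t"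
    then have "s \<in> T" using solution_segment_subset[OF \<phi> \<open>t0 \<in> T\<close> \<open>t \<in> T\<close>] by (auto simp: closed_segment_eq_real_ivl)
    note d = solution_derivs[OF \<phi> this]
    have "((\<lambda>s. W (\<phi> s) * exp (- 2 * s)) has_real_derivative
       2 * (a - 1) * ((\<phi> s $ 1)\<^sup>2 + (\<phi> s $ 2)\<^sup>2) * exp (- 2 * s)) (at s)"
      unfolding W_def by (rule derivative_eq_intros d refl)+ (simp add: algebra_simps power2_eq_square)
    moreover have "2 * (a - 1) * ((\<phi> s $ 1)\<^sup>2 + (\<phi> s $ 2)\<^sup>2) * exp (- 2 * s) \<le> 0"
      using \<open>a < 0\<close> by (intro mult_nonpos_nonneg[OF mult_nonpos_nonneg]) auto
    ultimately show "\<exists>y. ((\<lambda>s. W (\<phi> s) * exp (- 2 * s)) has_real_derivative y) (at s) \<and> y \<le> 0" by blast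
  qed
  then have "W (\<phi> t) * exp (- 2 * t) * exp (2 * t) \<le> W (\<phi> t0) * exp (- 2 * t0) * exp (2 * t)"
    by (rule mult_right_mono) simp
  then show ?thesis by (simp add: mult.assoc right_diff_distrib flip: exp_add)
qed

text \<open>If some later time \<open>c\<close> were missing, \<open>T\<close> would end at or
  before \<open>c\<close> and the solution would stay in one ball after \<open>t0\<close>. The
  existence time \<delta> is uniform on that ball, so restarting within \<delta> of the end of
  \<open>T\<close> gives an extension past it, against maximality.\<close>

lemma maximal_solution_forward_complete:
  assumes max: "maximal_solution (vfield a) T \<phi>" and "a < 0" "t0 \<in> T"
  shows "{t0..} \<subseteq> T"
proof (rule ccontr)
  assume "\<not> {t0..} \<subseteq> T"
  then obtain c where c: "c \<ge> t0" "c \<notin> T" by auto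
  have \<phi>: "solution_on (vfield a) T \<phi>" using max by (simp add: maximal_solution_def)
  then have T: "open T" "is_interval T" by (auto simp: solution_on_def)
  have below: "t \<le> c" if "t \<in> T" for t
    using T(2) that c \<open>t0 \<in> T\<close> unfolding is_interval_1 by (meson linear)
  define W where "W = (\<lambda>v::real^3. (v$1)\<^sup>2 + (v$2)\<^sup>2 + 2 * (v$3)\<^sup>2)"
  define R where "R = sqrt (W (\<phi> t0) * exp (2 * (c - t0)))"
  have R: "norm (\<phi> t) \<le> R" if "t \<in> T" "t0 \<le> t" for t
  proof -
    have "(norm (\<phi> t))\<^sup>2 \<le> W (\<phi> t)"
      by (simp add: W_def norm_vec_def L2_set_def sum_3 sum_nonneg)
    also have "\<dots> \<le> W (\<phi> t0) * exp (2 * (t - t0))"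
      using energy_growth[OF \<phi> \<open>a < 0\<close> \<open>t0 \<in> T\<close> that] by (simp add: W_def)
    also have "\<dots> \<le> W (\<phi> t0) * exp (2 * (c - t0))"
      using below[OF that(1)] by (intro mult_left_mono) (auto simp: W_def)
    finally show ?thesis unfolding R_def by (rule real_le_rsqrt)
  qed
  define \<delta> where "\<delta> = 1 / (\<bar>a\<bar> + 1 + R)"
  have "R \<ge> 0" using R[OF \<open>t0 \<in> T\<close>] norm_ge_zero order_trans by blast
  then have "\<delta> > 0" by (simp add: \<delta>_def add_nonneg_pos add_pos_nonneg)
  define d where "d = Sup T"
  have bdd: "bdd_above T" using below by (auto simp: bdd_above_def)
  have "d - \<delta> < Sup T" using \<open>\<delta> > 0\<close> by (simp add: d_def)
  then obtain t2 where t2: "t2 \<in> T" "d - \<delta> < t2"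
    using less_cSupD[of T] \<open>t0 \<in> T\<close> by blast
  \<comment> \<open>The norm bound holds only from \<open>t0\<close> on, so the restart must not
    precede \<open>t0\<close>.\<close>
  define t1 where "t1 = max t0 t2"
  have t1: "t1 \<in> T" "d - \<delta> < t1" "t0 \<le> t1" using t2 \<open>t0 \<in> T\<close> by (auto simp: t1_def max_def)
  have "t1 \<le> d" using cSup_upper[OF t1(1) bdd] by (simp add: d_def)
  obtain \<psi> where \<psi>: "\<psi> t1 = \<phi> t1" "solution_on (vfield a) {t1 - \<delta><..<t1 + \<delta>} \<psi>"
    by (rule local_solution[OF R[OF t1(1,3)] \<delta>_def])
  have "t1 \<in> {t1 - \<delta><..<t1 + \<delta>}" using \<open>\<delta> > 0\<close> by simp
  from solution_glue[OF \<phi> \<psi>(2) t1(1) this \<psi>(1)[symmetric]]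
  have "T \<union> {t1 - \<delta><..<t1 + \<delta>} = T"
    using max[unfolded maximal_solution_def, THEN conjunct2, rule_format,
        of "T \<union> {t1 - \<delta><..<t1 + \<delta>}" "\<lambda>t. if t \<in> T then \<phi> t else \<psi> t"] by simp
  moreover have "d \<in> {t1 - \<delta><..<t1 + \<delta>}" using t1 \<open>t1 \<le> d\<close> \<open>\<delta> > 0\<close> by simp
  ultimately have "d \<in> T" by blast
  then obtain e where "e > 0" "cball d e \<subseteq> T" using T(1) open_contains_cball by blast
  then have "d + e \<in> T" by (auto simp: dist_real_def)
  then show False using cSup_upper[of "d + e" T] bdd \<open>e > 0\<close> by (simp add: d_def)
qed

text \<open>Changing the first coordinate alone reaches one plane at cost |x - y| and the other at
  cost |x + y|. The distance is at most either cost, so its square is at most their product, which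
  is the quantity known to decay.\<close>

lemma infdist_planes_le:
  "(infdist v (plane_pos \<union> plane_neg))\<^sup>2 \<le> \<bar>(v$1)\<^sup>2 - (v$2)\<^sup>2\<bar>"
proof -
  define u w where "u = v$1 + v$2" and "w = v$1 - v$2"
  have pos: "infdist v (plane_pos \<union> plane_neg) \<le> \<bar>w\<bar>"
  proof -
    have "vector [v$2, v$2, v$3] \<in> plane_pos \<union> plane_neg" by (simp add: plane_pos_def)
    then have "infdist v (plane_pos \<union> plane_neg) \<le> dist v (vector [v$2, v$2, v$3])" by (rule infdist_le)
    also have "\<dots> \<le> \<bar>w\<bar>" using norm_vec3_le[of "v - vector [v$2, v$2, v$3]"] by (simp add: dist_norm w_def)
    finally show ?thesis .
  qed
  have neg: "infdist v (plane_pos \<union> plane_neg) \<le> \<bar>u\<bar>"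
  proof -
    have "vector [- v$2, v$2, v$3] \<in> plane_pos \<union> plane_neg" by (simp add: plane_neg_def)
    then have "infdist v (plane_pos \<union> plane_neg) \<le> dist v (vector [- v$2, v$2, v$3])" by (rule infdist_le)
    also have "\<dots> \<le> \<bar>u\<bar>" using norm_vec3_le[of "v - vector [- v$2, v$2, v$3]"] by (simp add: dist_norm u_def)
    finally show ?thesis .
  qed
  have "(infdist v (plane_pos \<union> plane_neg))\<^sup>2 \<le> \<bar>u\<bar> * \<bar>w\<bar>"
    unfolding power2_eq_square by (intro mult_mono neg pos) (auto simp: infdist_nonneg)
  then show ?thesis by (simp add: u_def w_def power2_eq_square algebra_simps flip: abs_mult)
qed

lemma maximal_solution_tends_to_planes:
  assumes max: "maximal_solution (vfield a) T \<phi>" and "a < 0"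
  shows "tends_to_set T \<phi> (plane_pos \<union> plane_neg)"
proof -
  have \<phi>: "solution_on (vfield a) T \<phi>" using max by (simp add: maximal_solution_def)
  then obtain t0 where "t0 \<in> T" by (auto simp: solution_on_def)
  have fwd: "{t0..} \<subseteq> T" by (rule maximal_solution_forward_complete[OF assms \<open>t0 \<in> T\<close>])
  define h where "h t = ((\<phi> t $ 1)\<^sup>2 - (\<phi> t $ 2)\<^sup>2) * exp (- 2 * a * t)" for t
  have h: "h t = h t0" if "t \<ge> t0" for t
  proof -
    have "(h has_real_derivative 0) (at s)" if "s \<in> {t0..}" for s
    proof -
      have "s \<in> T" using fwd that by blast
      note d = solution_derivs[OF \<phi> this]
      show ?thesis unfolding h_def
        by (rule derivative_eq_intros d refl)+ (simp add: algebra_simps power2_eq_square)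
    qed
    then obtain c where "\<And>s. s \<in> {t0..} \<Longrightarrow> h s = c"
      using has_field_derivative_zero_constant[of "{t0..}" h] by (auto intro: has_field_derivative_at_within)
    then show ?thesis using that by auto
  qed
  have lim: "((\<lambda>t. sqrt (\<bar>h t0\<bar> * exp (2 * a * t))) \<longlongrightarrow> sqrt (\<bar>h t0\<bar> * 0)) at_top"
  proof (intro tendsto_intros filterlim_compose[OF exp_at_bot])
    show "LIM t at_top. 2 * a * t :> at_bot"
      using \<open>a < 0\<close> by (intro filterlim_tendsto_neg_mult_at_bot[OF tendsto_const] filterlim_ident) auto
  qed
  have bound: "eventually (\<lambda>t. infdist (\<phi> t) (plane_pos \<union> plane_neg) \<le> sqrt (\<bar>h t0\<bar> * exp (2 * a * t))) at_top"
    using eventually_ge_at_top[of t0]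
  proof eventually_elim
    case (elim t)
    have "(\<phi> t $ 1)\<^sup>2 - (\<phi> t $ 2)\<^sup>2 = h t * exp (2 * a * t)"
      by (simp add: h_def mult.assoc flip: exp_add)
    then have "\<bar>(\<phi> t $ 1)\<^sup>2 - (\<phi> t $ 2)\<^sup>2\<bar> = \<bar>h t0\<bar> * exp (2 * a * t)"
      using h[OF elim] by (simp add: abs_mult)
    then show ?case using infdist_planes_le[of "\<phi> t"] by (intro real_le_rsqrt) simp
  qed
  have "((\<lambda>t. infdist (\<phi> t) (plane_pos \<union> plane_neg)) \<longlongrightarrow> 0) at_top"
    by (rule tendsto_sandwich[OF always_eventually bound tendsto_const])
      (use lim in \<open>simp_all add: infdist_nonneg\<close>)
  then show ?thesis using fwd by (auto simp: tends_to_set_def)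
qed

text \<open>The a priori bound is demanded of every backward extension \<psi>, so each restart may
  use the same existence time \<delta>. The reference point \<open>t0 + 1\<close> is used because
  \<open>t0\<close> itself lies outside the open domain of \<phi>.\<close>

lemma global_backward_extension:
  assumes \<phi>: "solution_on (vfield a) {t0<..} \<phi>"
    and R: "\<And>s \<psi> t. s \<le> t0 \<Longrightarrow> solution_on (vfield a) {s<..} \<psi> \<Longrightarrow> (\<And>t. t > t0 \<Longrightarrow> \<psi> t = \<phi> t) \<Longrightarrow>
        s < t \<Longrightarrow> t \<le> t0 + 1 \<Longrightarrow> norm (\<psi> t) \<le> R"
  obtains \<psi> where "solution_on (vfield a) UNIV \<psi>" "\<forall>t>t0. \<psi> t = \<phi> t"
proof -
  define \<delta> where "\<delta> = 1 / (\<bar>a\<bar> + 1 + R)"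
  have "norm (\<phi> (t0 + 1)) \<le> R" by (rule R[OF order_refl \<phi>]) auto
  then have "R \<ge> 0" using norm_ge_zero order_trans by blast
  then have "\<delta> > 0" "\<delta> \<le> 1" by (simp_all add: \<delta>_def field_simps)
  define e where "e n = t0 - real n * (\<delta> / 2)" for n
  have e: "e n \<le> t0" for n using \<open>\<delta> > 0\<close> by (simp add: e_def)
  have "\<exists>\<psi>. solution_on (vfield a) {e n<..} \<psi> \<and> (\<forall>t>t0. \<psi> t = \<phi> t)" for n
  proof (induction n)
    case 0
    then show ?case using \<phi> by (auto simp: e_def)
  next
    case (Suc n)
    then obtain \<psi> where \<psi>: "solution_on (vfield a) {e n<..} \<psi>" "\<And>t. t > t0 \<Longrightarrow> \<psi> t = \<phi> t" by blast
    \<comment> \<open>The restart lies strictly inside the open domain, and the new interval reaches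
      down to \<open>e n\<close> minus 3/4 of \<delta>, past \<open>e (Suc n)\<close>, which is only
      half of \<delta> below.\<close>
    define t1 where "t1 = e n + \<delta> / 4"
    have t1: "e n < t1" "t1 \<le> t0 + 1" using \<open>\<delta> > 0\<close> \<open>\<delta> \<le> 1\<close> e[of n] by (simp_all add: t1_def)
    have "norm (\<psi> t1) \<le> R" using R[OF e \<psi>(1)] \<psi>(2) t1 by blast
    obtain \<theta> where \<theta>: "\<theta> t1 = \<psi> t1" "solution_on (vfield a) {t1 - \<delta><..<t1 + \<delta>} \<theta>"
      by (rule local_solution[OF \<open>norm (\<psi> t1) \<le> R\<close> \<delta>_def])
    have "t1 \<in> {e n<..}" "t1 \<in> {t1 - \<delta><..<t1 + \<delta>}" using t1 \<open>\<delta> > 0\<close> by auto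
    from solution_glue[OF \<psi>(1) \<theta>(2) this \<theta>(1)[symmetric]]
    have "solution_on (vfield a) ({e n<..} \<union> {t1 - \<delta><..<t1 + \<delta>}) (\<lambda>t. if t \<in> {e n<..} then \<psi> t else \<theta> t)" .
    then have "solution_on (vfield a) {e (Suc n)<..} (\<lambda>t. if t \<in> {e n<..} then \<psi> t else \<theta> t)"
    proof (rule solution_on_subset)
      have "t1 - \<delta> < e (Suc n)" "e n < t1 + \<delta>" using \<open>\<delta> > 0\<close> by (simp_all add: t1_def e_def algebra_simps)
      then show "{e (Suc n)<..} \<subseteq> {e n<..} \<union> {t1 - \<delta><..<t1 + \<delta>}" by auto
    qed (auto simp: is_interval_convex_1)
    moreover have "e n < t" if "t > t0" for t using e[of n] that by simp
    ultimately show ?case using \<psi>(2)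
      by (intro exI[of _ "\<lambda>t. if t \<in> {e n<..} then \<psi> t else \<theta> t"]) simp
  qed
  then obtain \<Psi> where \<Psi>: "\<And>n. solution_on (vfield a) {e n<..} (\<Psi> n)" "\<And>n t. t > t0 \<Longrightarrow> \<Psi> n t = \<phi> t"
    by metis
  have agree: "\<Psi> m t = \<Psi> n t" if "e m < t" "e n < t" for m n t
  proof (rule solution_unique)
    show "solution_on (vfield a) {max (e m) (e n)<..} (\<Psi> m)" "solution_on (vfield a) {max (e m) (e n)<..} (\<Psi> n)"
      by (rule solution_on_subset[OF \<Psi>(1)]; auto simp: is_interval_convex_1)+
    show "t0 + 1 \<in> {max (e m) (e n)<..}" using e[of m] e[of n] by simp
    show "\<Psi> m (t0 + 1) = \<Psi> n (t0 + 1)" using \<Psi>(2) by simp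
  qed (use that in simp)
  \<comment> \<open>Any index whose domain contains \<open>t\<close> will do: by
    \<open>agree\<close> the value there is independent of the choice.\<close>
  define N where "N t = (SOME n. e n < t)" for t
  have N: "e (N t) < t" for t
  proof -
    obtain n where "t0 - t < real n * (\<delta> / 2)"
      using reals_Archimedean3[OF half_gt_zero[OF \<open>\<delta> > 0\<close>]] by blast
    then have "e n < t" by (simp add: e_def)
    then show ?thesis unfolding N_def by (rule someI)
  qed
  define \<psi> where "\<psi> t = \<Psi> (N t) t" for t
  have "(\<psi> has_vector_derivative vfield a (\<psi> t)) (at t)" for t
  proof (rule has_vector_derivative_transform_within_open[where S = "{e (N t)<..}" and f = "\<Psi> (N t)"])
    show "(\<Psi> (N t) has_vector_derivative vfield a (\<psi> t)) (at t)"
      using \<Psi>(1)[of "N t"] N[of t] by (simp add: solution_on_def \<psi>_def)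
    show "\<Psi> (N t) s = \<psi> s" if "s \<in> {e (N t)<..}" for s
      unfolding \<psi>_def by (rule agree) (use that N in auto)
  qed (use N in auto)
  then have "solution_on (vfield a) UNIV \<psi>" by (simp add: solution_on_def)
  moreover have "\<forall>t>t0. \<psi> t = \<phi> t" using \<Psi>(2) by (simp add: \<psi>_def)
  ultimately show ?thesis by (rule that)
qed

section \<open>The dynamics on an invariant plane\<close>

lemma le_increasing_deriv:
  fixes f :: "real \<Rightarrow> real"
  assumes "s \<le> t" "\<And>r. s \<le> r \<Longrightarrow> r \<le> t \<Longrightarrow> (f has_real_derivative f' r) (at r)"
    and "\<And>r. s \<le> r \<Longrightarrow> r \<le> t \<Longrightarrow> f' r \<ge> 0"
  shows "f s \<le> f t"
  using DERIV_nonneg_imp_nondecreasing[OF \<open>s \<le> t\<close>, of f] assms by blast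

text \<open>Twice the energy \<open>w'\<^sup>2 / 2 + exp (2 * w) / 2 - b * w\<close> of the oscillator, with its minimum subtracted.\<close>

definition energy :: "real \<Rightarrow> real \<Rightarrow> real \<Rightarrow> real" where
  "energy b x z = (z - b)\<^sup>2 + x\<^sup>2 - b - 2 * b * ln (x / sqrt b)"

text \<open>As ln x has derivative z - b, the force terms cancel and only the friction term is left.
  Its sign makes the energy grow forwards in time, so an energy level reached once bounds the whole
  past.\<close>

lemma has_real_derivative_energy:
  assumes "(x has_real_derivative (z t - b) * x t) (at t)" "(z has_real_derivative z t - (x t)\<^sup>2) (at t)"
    and "x t > 0" "b > 0"
  shows "((\<lambda>s. energy b (x s) (z s)) has_real_derivative 2 * (z t - b)\<^sup>2) (at t)"
proof -
  have d_ln: "((\<lambda>s. ln (x s / sqrt b)) has_real_derivative z t - b) (at t)"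
    using assms by (auto intro!: derivative_eq_intros simp: divide_simps)
  show ?thesis
    unfolding energy_def
    by (rule d_ln derivative_eq_intros assms(1,2) refl)+ (simp add: algebra_simps power2_eq_square)
qed

text \<open>The inequality ln s <= s - 1 at s = x / sqrt b completes the square. The companion bound
  \<open>energy_le\<close> applies the same inequality at b / x^2.\<close>

lemma energy_ge:
  assumes "b > 0" "x > 0"
  shows "(z - b)\<^sup>2 + (x - sqrt b)\<^sup>2 \<le> energy b x z"
proof -
  define s where "s = x / sqrt b"
  have "s > 0" using assms by (simp add: s_def)
  have "b * ln s \<le> b * (s - 1)" using assms \<open>s > 0\<close> by (intro mult_left_mono ln_le_minus_one) auto
  moreover have "x = s * sqrt b" "sqrt b * sqrt b = b" using assms by (simp_all add: s_def)
  then have "(x - sqrt b)\<^sup>2 = x\<^sup>2 - 2 * (b * s) + b" by (simp add: power2_eq_square algebra_simps)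
  ultimately show ?thesis by (simp add: energy_def s_def[symmetric] algebra_simps)
qed

lemma energy_le:
  assumes "b > 0" "x > 0"
  shows "energy b x z \<le> (z - b)\<^sup>2 + (x\<^sup>2 - b)\<^sup>2 / x\<^sup>2"
proof -
  have "- 2 * ln (x / sqrt b) = ln (b / x\<^sup>2)"
    using assms by (simp add: ln_div ln_realpow ln_sqrt)
  also have "\<dots> \<le> b / x\<^sup>2 - 1" using assms by (intro ln_le_minus_one) simp
  finally have "b * (- 2 * ln (x / sqrt b)) \<le> b * (b / x\<^sup>2 - 1)" using assms by (intro mult_left_mono) auto
  moreover have "(x\<^sup>2 - b)\<^sup>2 / x\<^sup>2 = x\<^sup>2 - b + b * (b / x\<^sup>2 - 1)"
    using assms by (simp add: field_simps power2_eq_square)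
  ultimately show ?thesis by (simp add: energy_def algebra_simps)
qed

text \<open>The squares bound x and z from above; the logarithm keeps x away from 0, where the bound
  of \<open>energy_le\<close> degenerates.\<close>

lemma energy_sublevel_bounds:
  assumes "b > 0" "x > 0" "energy b x z \<le> C"
  shows "x \<le> sqrt b + sqrt C" "\<bar>z\<bar> \<le> b + sqrt C" "sqrt b * exp (- (C + b) / (2 * b)) \<le> x"
proof -
  have sq: "(z - b)\<^sup>2 + (x - sqrt b)\<^sup>2 \<le> C" using energy_ge[OF assms(1,2), of z] assms(3) by linarith
  have "\<bar>z - b\<bar> \<le> sqrt C" "\<bar>x - sqrt b\<bar> \<le> sqrt C"
    using sq by (auto intro!: real_le_rsqrt simp: add_increasing add_increasing2 order_trans[rotated, OF sq])
  then show "x \<le> sqrt b + sqrt C" "\<bar>z\<bar> \<le> b + sqrt C" using assms(1) by auto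
  have "- b - 2 * b * ln (x / sqrt b) \<le> C"
    using assms(3) zero_le_power2[of "z - b"] zero_le_power2[of x] unfolding energy_def by linarith
  then have "- (C + b) / (2 * b) \<le> ln (x / sqrt b)" using assms(1) by (simp add: field_simps)
  then have "exp (- (C + b) / (2 * b)) \<le> x / sqrt b" using assms by (subst (asm) ln_ge_iff) auto
  then show "sqrt b * exp (- (C + b) / (2 * b)) \<le> x" using assms(1) by (simp add: field_simps)
qed

text \<open>On the past, the energy sublevel gives constants with L' >= k L, so \<open>L\<close>
  decays like exp (k t) as t tends to minus infinity; \<open>L\<close> in turn dominates the squared
  distance to the equilibrium.\<close>

lemma planar_backward_convergence:
  assumes "b > 0"
    and dx: "\<And>t. (x has_real_derivative (z t - b) * x t) (at t)"
    and dz: "\<And>t. (z has_real_derivative z t - (x t)\<^sup>2) (at t)"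
    and pos: "\<And>t. x t > 0"
  shows "(x \<longlongrightarrow> sqrt b) at_bot" "(z \<longlongrightarrow> b) at_bot"
proof -
  define G where "G t = energy b (x t) (z t)" for t
  define C where "C = G 0"
  have dG: "(G has_real_derivative 2 * (z t - b)\<^sup>2) (at t)" for t
    unfolding G_def by (rule has_real_derivative_energy[OF dx dz pos \<open>b > 0\<close>])
  have GC: "G t \<le> C" if "t \<le> 0" for t
    unfolding C_def using that dG by (rule le_increasing_deriv) simp
  have "C \<ge> 0" using energy_ge[OF \<open>b > 0\<close> pos[of 0], of "z 0"]
    by (simp add: C_def G_def) (metis add_nonneg_nonneg order_trans zero_le_power2)
  define X \<mu> where "X = sqrt b + sqrt C" and "\<mu> = sqrt b * exp (- (C + b) / (2 * b))"
  have X: "x t \<le> X" and \<mu>: "\<mu> \<le> x t" if "t \<le> 0" for t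
    using energy_sublevel_bounds[OF \<open>b > 0\<close> pos[of t], of "z t" C] GC[OF that] by (simp_all add: X_def \<mu>_def G_def)
  have "X > 0" "\<mu> > 0" using \<open>b > 0\<close> \<open>C \<ge> 0\<close> by (simp_all add: X_def \<mu>_def add_pos_nonneg)
  \<comment> \<open>Small enough for two purposes: \<eta> (1 + 2 X^2) <= 1 makes the derivative of
    \<open>L\<close> at least \<eta>/2 times p^2 + r^2, and \<eta> (X + sqrt b) <= 1 keeps the cross
    term below half of the energy.\<close>
  define \<eta> where "\<eta> = 1 / (1 + 2 * X\<^sup>2 + (X + sqrt b))"
  have \<eta>: "\<eta> > 0" "\<eta> * (1 + 2 * X\<^sup>2 + (X + sqrt b)) = 1"
  proof -
    have "1 + 2 * X\<^sup>2 + (X + sqrt b) > 0" using \<open>X > 0\<close> \<open>b > 0\<close> by (simp add: add_pos_nonneg)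
    then show "\<eta> > 0" "\<eta> * (1 + 2 * X\<^sup>2 + (X + sqrt b)) = 1" unfolding \<eta>_def by simp_all
  qed
  have "\<eta> * X\<^sup>2 \<ge> 0" "\<eta> * (X + sqrt b) \<ge> 0" using \<eta>(1) \<open>X > 0\<close> \<open>b > 0\<close> by simp_all
  moreover have "\<eta> + 2 * (\<eta> * X\<^sup>2) + \<eta> * (X + sqrt b) = 1" using \<eta>(2) by (simp add: algebra_simps)
  ultimately have \<eta>X: "\<eta> + 2 * (\<eta> * X\<^sup>2) \<le> 1" "\<eta> * (X + sqrt b) \<le> 1" "\<eta> \<le> 1"
    using \<eta>(1) by linarith+
  define p r q where "p t = z t - b" and "r t = (x t)\<^sup>2 - b" and "q t = x t - sqrt b" for t
  \<comment> \<open>\<open>G\<close> alone has the degenerate derivative \<open>2 * p\<^sup>2\<close>; the cross term adds a multiple of \<open>r\<^sup>2\<close>.\<close>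
  define L where "L t = G t - \<eta> * (p t * r t)" for t
  have dL: "(L has_real_derivative 2 * (p t)\<^sup>2 - \<eta> * (p t * r t - (r t)\<^sup>2 + 2 * (p t)\<^sup>2 * (x t)\<^sup>2)) (at t)" for t
    unfolding L_def p_def r_def
    by (rule derivative_eq_intros dG dx dz refl)+ (simp add: algebra_simps power2_eq_square)
  have L_upper: "L t \<le> (2 + 1 / \<mu>\<^sup>2) * ((p t)\<^sup>2 + (r t)\<^sup>2)" if "t \<le> 0" for t
  proof -
    have "\<mu>\<^sup>2 \<le> (x t)\<^sup>2" using \<mu>[OF that] \<open>\<mu> > 0\<close> by (intro power_mono) auto
    then have "(r t)\<^sup>2 / (x t)\<^sup>2 \<le> (r t)\<^sup>2 / \<mu>\<^sup>2" using \<open>\<mu> > 0\<close> pos[of t] by (intro divide_left_mono) auto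
    moreover have "G t \<le> (p t)\<^sup>2 + (r t)\<^sup>2 / (x t)\<^sup>2" unfolding G_def p_def r_def by (rule energy_le[OF \<open>b > 0\<close> pos])
    moreover have "- (\<eta> * (p t * r t)) \<le> (p t)\<^sup>2 + (r t)\<^sup>2"
    proof -
      have "- (p t * r t) \<le> (p t)\<^sup>2 + (r t)\<^sup>2"
        using zero_le_power2[of "p t + r t"] zero_le_power2[of "p t"] zero_le_power2[of "r t"]
        unfolding power2_sum by linarith
      then have "\<eta> * (- (p t * r t)) \<le> \<eta> * ((p t)\<^sup>2 + (r t)\<^sup>2)" using \<eta>(1) by (intro mult_left_mono) auto
      also have "\<dots> \<le> (p t)\<^sup>2 + (r t)\<^sup>2" using \<eta>X(3) \<eta>(1) by (intro mult_left_le_one_le) auto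
      finally show ?thesis by simp
    qed
    moreover have "(p t)\<^sup>2 / \<mu>\<^sup>2 \<ge> 0" "(r t)\<^sup>2 \<ge> 0" by simp_all
    moreover have "(2 + 1 / \<mu>\<^sup>2) * ((p t)\<^sup>2 + (r t)\<^sup>2) =
        2 * (p t)\<^sup>2 + 2 * (r t)\<^sup>2 + (p t)\<^sup>2 / \<mu>\<^sup>2 + (r t)\<^sup>2 / \<mu>\<^sup>2"
      by (simp add: algebra_simps)
    ultimately show ?thesis unfolding L_def by linarith
  qed
  have L_lower: "(p t)\<^sup>2 + (q t)\<^sup>2 \<le> 2 * L t" if "t \<le> 0" for t
  proof -
    have "r t = q t * (x t + sqrt b)" using \<open>b > 0\<close> by (simp add: r_def q_def algebra_simps power2_eq_square)
    then have "\<bar>p t * r t\<bar> = \<bar>p t\<bar> * \<bar>q t\<bar> * (x t + sqrt b)" using pos[of t] \<open>b > 0\<close> by (simp add: abs_mult)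
    also have "\<dots> \<le> \<bar>p t\<bar> * \<bar>q t\<bar> * (X + sqrt b)" using X[OF that] by (intro mult_left_mono) auto
    finally have "\<eta> * \<bar>p t * r t\<bar> \<le> \<eta> * (\<bar>p t\<bar> * \<bar>q t\<bar> * (X + sqrt b))" using \<eta>(1) by (intro mult_left_mono) auto
    also have "\<dots> = \<bar>p t\<bar> * \<bar>q t\<bar> * (\<eta> * (X + sqrt b))" by (simp add: mult_ac)
    also have "\<dots> \<le> \<bar>p t\<bar> * \<bar>q t\<bar>" using \<eta>X(2) by (intro mult_left_le) auto
    finally have A: "\<eta> * (p t * r t) \<le> \<bar>p t\<bar> * \<bar>q t\<bar>"
      using \<eta>(1) mult_left_mono[OF abs_ge_self[of "p t * r t"], of \<eta>] by linarith
    have "2 * (\<bar>p t\<bar> * \<bar>q t\<bar>) \<le> (p t)\<^sup>2 + (q t)\<^sup>2"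
      using zero_le_power2[of "\<bar>p t\<bar> - \<bar>q t\<bar>"] by (simp add: power2_diff)
    with A have "2 * (\<eta> * (p t * r t)) \<le> (p t)\<^sup>2 + (q t)\<^sup>2"
      by (meson mult_left_mono order_trans zero_le_numeral)
    moreover have "(p t)\<^sup>2 + (q t)\<^sup>2 \<le> G t" unfolding p_def q_def G_def by (rule energy_ge[OF \<open>b > 0\<close> pos])
    ultimately show ?thesis unfolding L_def right_diff_distrib[of 2] mult_2[of "G t"] by linarith
  qed
  \<comment> \<open>The ratio of the lower bound \<eta>/2 for L' to the upper bound 2 + 1/\<mu>^2
    for \<open>L\<close>, both measured against p^2 + r^2.\<close>
  define k where "k = \<eta> / 2 / (2 + 1 / \<mu>\<^sup>2)"
  have K: "2 + 1 / \<mu>\<^sup>2 > 0" by (simp add: add_pos_nonneg)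
  have "k > 0" using K \<eta>(1) by (simp add: k_def)
  have dL_ge: "2 * (p t)\<^sup>2 - \<eta> * (p t * r t - (r t)\<^sup>2 + 2 * (p t)\<^sup>2 * (x t)\<^sup>2) \<ge> k * L t" if "t \<le> 0" for t
  proof -
    have "k * L t \<le> k * ((2 + 1 / \<mu>\<^sup>2) * ((p t)\<^sup>2 + (r t)\<^sup>2))" using L_upper[OF that] \<open>k > 0\<close> by simp
    also have "\<dots> = k * (2 + 1 / \<mu>\<^sup>2) * ((p t)\<^sup>2 + (r t)\<^sup>2)" by (simp only: mult.assoc)
    also have "k * (2 + 1 / \<mu>\<^sup>2) = \<eta> / 2" using K unfolding k_def by (simp only: nonzero_divide_eq_eq times_divide_eq_left) simp
    finally have 1: "k * L t \<le> \<eta> / 2 * ((p t)\<^sup>2 + (r t)\<^sup>2)" .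
    have "(x t)\<^sup>2 \<le> X\<^sup>2" using X[OF that] pos[of t] by (intro power_mono) auto
    then have "\<eta> * (x t)\<^sup>2 \<le> \<eta> * X\<^sup>2" using \<eta>(1) by (intro mult_left_mono) auto
    then have "(p t)\<^sup>2 * (2 - 2 * (\<eta> * (x t)\<^sup>2) - \<eta>) \<ge> 0"
      using \<eta>X(1) by (intro mult_nonneg_nonneg) auto
    moreover have "\<eta> * (p t - r t)\<^sup>2 \<ge> 0" using \<eta>(1) by simp
    ultimately show ?thesis using 1 by (simp add: algebra_simps power2_diff)
  qed
  have decay: "L t \<le> L 0 * exp (k * t)" if "t \<le> 0" for t
  proof -
    define h where "h s = L s * exp (- k * s)" for s
    have "h t \<le> h 0"
    proof (rule le_increasing_deriv[OF that])
      fix s assume "t \<le> s" "s \<le> (0::real)"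
      let ?D = "2 * (p s)\<^sup>2 - \<eta> * (p s * r s - (r s)\<^sup>2 + 2 * (p s)\<^sup>2 * (x s)\<^sup>2)"
      show "(h has_real_derivative (?D - k * L s) * exp (- k * s)) (at s)"
        unfolding h_def by (rule derivative_eq_intros dL refl)+ (simp add: algebra_simps)
      show "(?D - k * L s) * exp (- k * s) \<ge> 0" using dL_ge[OF \<open>s \<le> 0\<close>] by simp
    qed
    then have "L t * exp (- k * t) * exp (k * t) \<le> L 0 * exp (k * t)"
      unfolding h_def by (intro mult_right_mono) auto
    then show ?thesis by (simp add: mult.assoc flip: exp_add)
  qed
  have "LIM t at_bot. k * t :> at_bot"
    using \<open>k > 0\<close> by (rule filterlim_tendsto_pos_mult_at_bot[OF tendsto_const _ filterlim_ident])
  then have "((\<lambda>t. exp (k * t)) \<longlongrightarrow> 0) at_bot" by (rule filterlim_compose[OF exp_at_bot])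
  from tendsto_real_sqrt[OF tendsto_mult_left[OF this, of "2 * L 0"]]
  have lim: "((\<lambda>t. sqrt (2 * L 0 * exp (k * t))) \<longlongrightarrow> 0) at_bot" by simp
  have sq: "(p t)\<^sup>2 + (q t)\<^sup>2 \<le> 2 * L 0 * exp (k * t)" if "t \<le> 0" for t
    using decay[OF that] L_lower[OF that] by linarith
  have bp: "\<forall>\<^sub>F t in at_bot. norm (p t) \<le> sqrt (2 * L 0 * exp (k * t))"
    using eventually_le_at_bot[of 0]
  proof eventually_elim
    case (elim t)
    have "\<bar>p t\<bar>\<^sup>2 \<le> 2 * L 0 * exp (k * t)" using sq[OF elim] zero_le_power2[of "q t"] unfolding power2_abs by linarith
    then show ?case by (simp add: real_le_rsqrt)
  qed
  have bq: "\<forall>\<^sub>F t in at_bot. norm (q t) \<le> sqrt (2 * L 0 * exp (k * t))"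
    using eventually_le_at_bot[of 0]
  proof eventually_elim
    case (elim t)
    have "\<bar>q t\<bar>\<^sup>2 \<le> 2 * L 0 * exp (k * t)" using sq[OF elim] zero_le_power2[of "p t"] unfolding power2_abs by linarith
    then show ?case by (simp add: real_le_rsqrt)
  qed
  show "(x \<longlongrightarrow> sqrt b) at_bot" using Lim_null_comparison[OF bq lim] by (simp add: q_def LIM_zero_iff)
  show "(z \<longlongrightarrow> b) at_bot" using Lim_null_comparison[OF bp lim] by (simp add: p_def LIM_zero_iff)
qed

section \<open>The stable branch of the origin\<close>

text \<open>Write x^2 = \<xi> Q and z = \<xi> D with \<xi>' = -2 b \<xi>. The equation for x^2
  becomes b Q' = - D Q, and the one for z gives D_n = Q_n / (1 + 2 b (n + 1)); eliminating D leaves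
  this recursion for Q. All divisors are positive for b > 0, so no resonance occurs. The
  normalisation Q_0 = 1 fixes the time translation.\<close>

fun stable_coeff :: "real \<Rightarrow> nat \<Rightarrow> real" where
  "stable_coeff b 0 = 1"
| "stable_coeff b (Suc n) =
    - (\<Sum>i\<le>n. stable_coeff b i / (1 + 2 * b * real (Suc i)) * stable_coeff b (n - i)) / (b * real (Suc n))"

text \<open>The n + 1 products are divided by b (n + 1), so each step costs only 1/b; dividing by 1
  + 2 b (n + 1) >= 1 only shrinks. Both series therefore converge for |\<xi>| < b.\<close>

lemma abs_stable_coeff_le:
  assumes "b > 0"
  shows "\<bar>stable_coeff b n\<bar> \<le> (1 / b) ^ n"
    and "\<bar>stable_coeff b n / (1 + 2 * b * real (Suc n))\<bar> \<le> (1 / b) ^ n"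
proof -
  have div: "\<bar>c / (1 + 2 * b * real (Suc n))\<bar> \<le> B" if "\<bar>c\<bar> \<le> B" for c B n
  proof -
    have "1 + 2 * b * real (Suc n) \<ge> 1" using assms by simp
    then have "\<bar>c / (1 + 2 * b * real (Suc n))\<bar> \<le> \<bar>c\<bar>"
      unfolding abs_divide by (simp add: divide_le_eq mult_le_cancel_left1)
    then show ?thesis using that by linarith
  qed
  show 1: "\<bar>stable_coeff b n\<bar> \<le> (1 / b) ^ n" for n
  proof (induction n rule: less_induct)
    case (less n)
    show ?case
    proof (cases n)
      case (Suc m)
      have "\<bar>\<Sum>i\<le>m. stable_coeff b i / (1 + 2 * b * real (Suc i)) * stable_coeff b (m - i)\<bar>
          \<le> real (Suc m) * (1 * 1 * (1 / b) ^ m)"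
      proof (rule abs_convolution_le)
        fix i assume "i \<le> m"
        then have *: "\<bar>stable_coeff b i\<bar> \<le> (1 / b) ^ i" using less Suc by simp
        then show "\<bar>stable_coeff b i\<bar> \<le> 1 * (1 / b) ^ i" by simp
        show "\<bar>stable_coeff b i / (1 + 2 * b * real (Suc i))\<bar> \<le> 1 * (1 / b) ^ i"
          using div[OF *] by simp
      qed (use assms in auto)
      then have "\<bar>stable_coeff b n\<bar> \<le> real (Suc m) * (1 / b) ^ m / (b * real (Suc m))"
        using assms unfolding Suc stable_coeff.simps abs_divide abs_minus_cancel
        by (intro divide_mono) (auto simp: abs_mult)
      also have "\<dots> = (1 / b) ^ n" using assms by (simp add: Suc power_one_over divide_simps del: of_nat_Suc)
      finally show ?thesis .
    qed simp
  qed
  show "\<bar>stable_coeff b n / (1 + 2 * b * real (Suc n))\<bar> \<le> (1 / b) ^ n"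
    by (rule div[OF 1])
qed

text \<open>The stable branch of the origin with \<open>x > 0\<close> is expanded in powers of \<open>\<xi> = exp (- 2 * b * t)\<close>:
  \<open>x\<^sup>2 = \<xi> * Q \<xi>\<close> and \<open>z = P \<xi>\<close>.\<close>

lemma stable_branch:
  assumes "b > 0"
  obtains t0 and x z :: "real \<Rightarrow> real" where
    "\<forall>t>t0. (x has_real_derivative (z t - b) * x t) (at t)"
    "\<forall>t>t0. (z has_real_derivative z t - (x t)\<^sup>2) (at t)"
    "\<forall>t>t0. x t > 0" "(x \<longlongrightarrow> 0) at_top" "(z \<longlongrightarrow> 0) at_top"
proof -
  define Q D P where "Q = Abs_fps (stable_coeff b)"
    and "D = Abs_fps (\<lambda>n. stable_coeff b n / (1 + 2 * b * real (Suc n)))" and "P = fps_X * D"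
  have "ereal (1 / (1 / b)) \<le> fps_conv_radius Q"
    by (rule fps_conv_radius_ge_of_geometric_bound[where C = 1])
      (use abs_stable_coeff_le(1)[OF assms] assms in \<open>simp_all add: Q_def\<close>)
  moreover have "ereal (1 / (1 / b)) \<le> fps_conv_radius D"
    by (rule fps_conv_radius_ge_of_geometric_bound[where C = 1])
      (use abs_stable_coeff_le(2)[OF assms] assms in \<open>simp_all add: D_def\<close>)
  ultimately have rad: "ereal b \<le> fps_conv_radius Q" "ereal b \<le> fps_conv_radius D" by simp_all
  then have radP: "ereal b \<le> fps_conv_radius P"
    using fps_conv_radius_mult[of fps_X D] by (simp add: P_def order_trans)
  have Q': "fps_deriv Q = fps_const (- (1 / b)) * (D * Q)"
  proof (rule fps_ext)
    fix n
    have "real (Suc n) * stable_coeff b (Suc n) =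
      - (1 / b) * (\<Sum>i\<le>n. stable_coeff b i / (1 + 2 * b * real (Suc i)) * stable_coeff b (n - i))"
      using assms by (simp del: of_nat_Suc add: field_simps)
    then show "fps_nth (fps_deriv Q) n = fps_nth (fps_const (- (1 / b)) * (D * Q)) n"
      by (simp add: Q_def D_def fps_mult_nth[of "Abs_fps f" "Abs_fps g" for f g] atLeast0AtMost del: stable_coeff.simps)
  qed
  have P': "fps_const (2 * b) * fps_deriv P = Q - D"
  proof (rule fps_ext)
    fix n
    have "1 + 2 * b * real (Suc n) > 0" using assms by (simp add: add_pos_nonneg)
    then show "fps_nth (fps_const (2 * b) * fps_deriv P) n = fps_nth (Q - D) n"
      by (simp add: P_def Q_def D_def divide_simps) (simp add: algebra_simps)
  qed
  define \<xi> where "\<xi> t = exp (- 2 * b * t)" for t :: real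
  have "LIM t at_top. - 2 * b * t :> at_bot"
    using assms by (intro filterlim_tendsto_neg_mult_at_bot[OF tendsto_const _ filterlim_ident]) auto
  then have \<xi>0: "(\<xi> \<longlongrightarrow> 0) at_top"
    unfolding \<xi>_def by (rule filterlim_compose[OF exp_at_bot])
  have cont: "isCont (eval_fps F) 0" if "ereal b \<le> fps_conv_radius F" for F :: "real fps"
    using continuous_eval_fps[of 0 F UNIV] order_less_le_trans[OF _ that, of "ereal 0"] assms
    by (simp add: zero_ereal_def)
  have "((\<lambda>t. eval_fps Q (\<xi> t)) \<longlongrightarrow> eval_fps Q 0) at_top"
    by (rule isCont_tendsto_compose[OF cont[OF rad(1)] \<xi>0])
  then have Qlim: "((\<lambda>t. eval_fps Q (\<xi> t)) \<longlongrightarrow> 1) at_top" by (simp add: eval_fps_at_0 Q_def)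
  have "((\<lambda>t. eval_fps P (\<xi> t)) \<longlongrightarrow> eval_fps P 0) at_top"
    by (rule isCont_tendsto_compose[OF cont[OF radP] \<xi>0])
  then have Plim: "((\<lambda>t. eval_fps P (\<xi> t)) \<longlongrightarrow> 0) at_top" by (simp add: eval_fps_at_0 P_def)
  have "\<forall>\<^sub>F t in at_top. \<xi> t < b \<and> eval_fps Q (\<xi> t) > 0"
    using order_tendstoD(2)[OF \<xi>0 assms] order_tendstoD(1)[OF Qlim, of 0] by (simp add: eventually_conj)
  \<comment> \<open>From \<open>t0\<close> on, \<xi> lies inside the disc of convergence and
    \<open>Q\<close> is positive, so that the square root defining \<open>x\<close> is
    differentiable.\<close>
  then obtain t0 where t0: "\<And>t. t \<ge> t0 \<Longrightarrow> \<xi> t < b \<and> eval_fps Q (\<xi> t) > 0"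
    unfolding eventually_at_top_linorder by blast
  define q where "q t = \<xi> t * eval_fps Q (\<xi> t)" for t
  define x where "x t = sqrt (q t)" for t
  define z where "z t = eval_fps P (\<xi> t)" for t
  have \<xi>pos: "\<xi> t > 0" for t by (simp add: \<xi>_def)
  have \<xi>': "(\<xi> has_real_derivative - 2 * b * \<xi> t) (at t)" for t
    unfolding \<xi>_def by (auto intro!: derivative_eq_intros)
  have qpos: "q t > 0" if "t > t0" for t using t0[of t] \<xi>pos[of t] that by (simp add: q_def)
  have ev: "((\<lambda>s. eval_fps F (\<xi> s)) has_real_derivative eval_fps (fps_deriv F) (\<xi> t) * (- 2 * b * \<xi> t)) (at t)"
    if "t > t0" "ereal b \<le> fps_conv_radius F" for F t
  proof (rule DERIV_chain2[OF has_field_derivative_eval_fps \<xi>'])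
    have "norm (\<xi> t) < b" using t0[of t] \<xi>pos[of t] that by simp
    then show "ereal (norm (\<xi> t)) < fps_conv_radius F" using that(2) by (metis less_ereal.simps(1) order_less_le_trans)
  qed
  have z': "(z has_real_derivative z t - q t) (at t)" and q': "(q has_real_derivative 2 * (z t - b) * q t) (at t)" if "t > t0" for t
  proof -
    have r: "ereal \<bar>\<xi> t\<bar> < ereal b" using t0[of t] \<xi>pos[of t] that by simp
    note r1 = order_less_le_trans[OF r rad(1)] order_less_le_trans[OF r rad(2)] order_less_le_trans[OF r radP]
    have rm: "ereal \<bar>\<xi> t\<bar> < fps_conv_radius (D * Q)"
      using fps_conv_radius_mult[of D Q] r1 by (meson min_less_iff_conj order_less_le_trans)
    have rd: "ereal \<bar>\<xi> t\<bar> < fps_conv_radius (fps_deriv P)"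
      using fps_conv_radius_deriv[of P] r1(3) by (meson order_less_le_trans)
    have eD: "z t = \<xi> t * eval_fps D (\<xi> t)" using r1 by (simp add: z_def P_def eval_fps_mult)
    have eQ': "eval_fps (fps_deriv Q) (\<xi> t) = - (1 / b) * (eval_fps D (\<xi> t) * eval_fps Q (\<xi> t))"
      unfolding Q' using r1 rm by (simp add: eval_fps_mult)
    have "eval_fps (fps_const (2 * b) * fps_deriv P) (\<xi> t) = eval_fps Q (\<xi> t) - eval_fps D (\<xi> t)"
      unfolding P' using r1 by (simp add: eval_fps_diff)
    then have eP': "2 * b * eval_fps (fps_deriv P) (\<xi> t) = eval_fps Q (\<xi> t) - eval_fps D (\<xi> t)"
      using rd by (simp add: eval_fps_mult)
    have "eval_fps (fps_deriv P) (\<xi> t) * (- 2 * b * \<xi> t) = z t - q t"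
      using eP' unfolding eD q_def by algebra
    then show "(z has_real_derivative z t - q t) (at t)"
      using ev[OF that radP] by (simp add: z_def[abs_def])
    have "(q has_real_derivative (- 2 * b * \<xi> t) * eval_fps Q (\<xi> t)
        + (eval_fps (fps_deriv Q) (\<xi> t) * (- 2 * b * \<xi> t)) * \<xi> t) (at t)"
      unfolding q_def by (rule DERIV_mult[OF \<xi>' ev[OF that rad(1)]])
    also have "(- 2 * b * \<xi> t) * eval_fps Q (\<xi> t) + (eval_fps (fps_deriv Q) (\<xi> t) * (- 2 * b * \<xi> t)) * \<xi> t
        = 2 * (z t - b) * q t"
      unfolding eQ' eD q_def using assms by (simp add: field_simps)
    finally show "(q has_real_derivative 2 * (z t - b) * q t) (at t)" .
  qed
  have sol: "(x has_real_derivative (z t - b) * x t) (at t)" "(z has_real_derivative z t - (x t)\<^sup>2) (at t)"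
    "x t > 0" if t: "t > t0" for t
  proof -
    have xq: "(x t)\<^sup>2 = q t" using qpos[OF t] by (simp add: x_def)
    show "x t > 0" using qpos[OF t] by (simp add: x_def)
    have "(x has_real_derivative 2 * (z t - b) * q t * (inverse (sqrt (q t)) / 2)) (at t)"
      unfolding x_def using DERIV_chain2[OF DERIV_real_sqrt[OF qpos[OF t]] q'[OF t]] by (simp add: mult_ac)
    moreover have "2 * (z t - b) * q t * (inverse (sqrt (q t)) / 2) = (z t - b) * x t"
      using \<open>x t > 0\<close> unfolding xq[symmetric] by (simp add: field_simps power2_eq_square)
    ultimately show "(x has_real_derivative (z t - b) * x t) (at t)" by simp
    show "(z has_real_derivative z t - (x t)\<^sup>2) (at t)" using z'[OF t] xq by simp
  qed
  have "(q \<longlongrightarrow> 0) at_top" unfolding q_def using tendsto_mult[OF \<xi>0 Qlim] by simp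
  then have "(x \<longlongrightarrow> 0) at_top" unfolding x_def using tendsto_real_sqrt by fastforce
  moreover have "(z \<longlongrightarrow> 0) at_top" unfolding z_def by (rule Plim)
  ultimately show ?thesis using sol by (intro that[of t0 x z]) auto
qed

text \<open>On x = y a zero of x is also a zero of x + y, and invariance of the other plane would
  carry it to \<open>t1\<close>, where x + y > 0. Hence x has no zero and, by connectedness, keeps
  its sign; the logarithm in the energy needs this.\<close>

lemma plane_branch:
  assumes \<psi>: "solution_on (vfield (- b)) T \<psi>" and t1: "t1 \<in> T" "\<psi> t1 $ 1 = \<psi> t1 $ 2" "\<psi> t1 $ 1 > 0"
    and t: "t \<in> T"
  shows "\<psi> t $ 2 = \<psi> t $ 1" "\<psi> t $ 1 > 0"
    "((\<lambda>s. \<psi> s $ 1) has_real_derivative (\<psi> t $ 3 - b) * \<psi> t $ 1) (at t)"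
    "((\<lambda>s. \<psi> s $ 3) has_real_derivative \<psi> t $ 3 - (\<psi> t $ 1)\<^sup>2) (at t)"
proof -
  have eq: "\<psi> s $ 2 = \<psi> s $ 1" if "s \<in> T" for s
    using planes_zero_invariant[OF \<psi>, of "-1" t1 s] t1 that by simp
  have nz: "\<psi> s $ 1 \<noteq> 0" if "s \<in> T" for s
    using planes_zero_invariant[OF \<psi>, of 1 s t1] t1 that eq[OF that] by auto
  have "continuous_on T (\<lambda>s. \<psi> s $ 1)"
    using solution_derivs(1)[OF \<psi>] by (intro continuous_at_imp_continuous_on ballI DERIV_isCont) blast
  then have "connected ((\<lambda>s. \<psi> s $ 1) ` T)"
    using \<psi> by (intro connected_continuous_image) (auto simp: solution_on_def is_interval_connected_1)
  then have int: "is_interval ((\<lambda>s. \<psi> s $ 1) ` T)" by (simp add: is_interval_connected_1)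
  have "\<psi> t $ 1 > 0"
  proof (rule ccontr)
    assume "\<not> \<psi> t $ 1 > 0"
    then have "0 \<in> (\<lambda>s. \<psi> s $ 1) ` T"
      using mem_is_interval_1_I[OF int imageI[OF t] imageI[OF t1(1)], of 0] t1(3) by simp
    then show False using nz by auto
  qed
  then show "\<psi> t $ 1 > 0" "\<psi> t $ 2 = \<psi> t $ 1" using eq t by auto
  show "((\<lambda>s. \<psi> s $ 1) has_real_derivative (\<psi> t $ 3 - b) * \<psi> t $ 1) (at t)"
    using solution_derivs(1)[OF \<psi> t] eq[OF t] by (simp add: algebra_simps)
  show "((\<lambda>s. \<psi> s $ 3) has_real_derivative \<psi> t $ 3 - (\<psi> t $ 1)\<^sup>2) (at t)"
    using solution_derivs(3)[OF \<psi> t] eq[OF t] by (simp add: power2_eq_square)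
qed

text \<open>The series describes the branch only for late times. Its energy at \<open>t0 + 1\<close>
  supplies the a priori bound for \<open>global_backward_extension\<close>, and the extended
  solution then satisfies the hypotheses of \<open>planar_backward_convergence\<close>.\<close>

lemma planar_connection:
  assumes "b > 0"
  obtains x z :: "real \<Rightarrow> real" where
    "\<forall>t. (x has_real_derivative (z t - b) * x t) (at t)"
    "\<forall>t. (z has_real_derivative z t - (x t)\<^sup>2) (at t)"
    "\<forall>t. x t > 0"
    "(x \<longlongrightarrow> 0) at_top" "(z \<longlongrightarrow> 0) at_top" "(x \<longlongrightarrow> sqrt b) at_bot" "(z \<longlongrightarrow> b) at_bot"
proof -
  obtain x z t0 where
    dx: "\<forall>t>t0. (x has_real_derivative (z t - b) * x t) (at t)" and
    dz: "\<forall>t>t0. (z has_real_derivative z t - (x t)\<^sup>2) (at t)" and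
    pos: "\<forall>t>t0. x t > 0" and lim: "(x \<longlongrightarrow> 0) at_top" "(z \<longlongrightarrow> 0) at_top"
    by (rule stable_branch[OF assms])
  define \<phi> where "\<phi> t = (vector [x t, x t, z t] :: real^3)" for t
  have \<phi>: "solution_on (vfield (- b)) {t0<..} \<phi>"
    using dx dz by (auto simp: solution_on_def is_interval_convex_1 has_vector_derivative_vec3 \<phi>_def
        algebra_simps power2_eq_square)
  define C where "C = energy b (x (t0 + 1)) (z (t0 + 1))"
  obtain \<psi> where \<psi>: "solution_on (vfield (- b)) UNIV \<psi>" "\<forall>t>t0. \<psi> t = \<phi> t"
  proof (rule global_backward_extension[OF \<phi>])
    fix s \<psi> t
    assume "s \<le> t0" and \<psi>: "solution_on (vfield (- b)) {s<..} \<psi>" and "\<And>t. t > t0 \<Longrightarrow> \<psi> t = \<phi> t"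
      and "s < t" "t \<le> t0 + 1"
    then have "\<psi> (t0 + 1) = \<phi> (t0 + 1)" by simp
    then have init: "t0 + 1 \<in> {s<..}" "\<psi> (t0 + 1) $ 1 = \<psi> (t0 + 1) $ 2" "\<psi> (t0 + 1) $ 1 > 0"
      and C: "energy b (\<psi> (t0 + 1) $ 1) (\<psi> (t0 + 1) $ 3) = C"
      using \<open>s \<le> t0\<close> pos by (simp_all add: \<phi>_def C_def)
    note branch = plane_branch[OF \<psi> init]
    have "energy b (\<psi> t $ 1) (\<psi> t $ 3) \<le> energy b (\<psi> (t0 + 1) $ 1) (\<psi> (t0 + 1) $ 3)"
    proof (rule le_increasing_deriv[OF \<open>t \<le> t0 + 1\<close>])
      fix r assume "t \<le> r" "r \<le> t0 + 1"
      then have "r \<in> {s<..}" using \<open>s < t\<close> by simp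
      from branch(3,4,2)[OF this] \<open>b > 0\<close>
      show "((\<lambda>r. energy b (\<psi> r $ 1) (\<psi> r $ 3)) has_real_derivative 2 * (\<psi> r $ 3 - b)\<^sup>2) (at r)"
        by (rule has_real_derivative_energy)
    qed simp
    then have "energy b (\<psi> t $ 1) (\<psi> t $ 3) \<le> C" using C by simp
    moreover have "t \<in> {s<..}" using \<open>s < t\<close> by simp
    note b = branch(1,2)[OF this]
    ultimately have "\<bar>\<psi> t $ 1\<bar> \<le> sqrt b + sqrt C" "\<bar>\<psi> t $ 3\<bar> \<le> b + sqrt C"
      using energy_sublevel_bounds(1,2)[OF assms b(2)] b(2) by auto
    then show "norm (\<psi> t) \<le> 2 * (sqrt b + sqrt C) + (b + sqrt C)"
      using norm_vec3_le[of "\<psi> t"] b(1) by simp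
  qed
  have "t0 + 1 \<in> UNIV" "\<psi> (t0 + 1) $ 1 = \<psi> (t0 + 1) $ 2" "\<psi> (t0 + 1) $ 1 > 0"
    using \<psi>(2) pos by (simp_all add: \<phi>_def)
  note branch = plane_branch[OF \<psi>(1) this UNIV_I]
  show ?thesis
  proof (rule that[of "\<lambda>t. \<psi> t $ 1" "\<lambda>t. \<psi> t $ 3"])
    have "\<forall>\<^sub>F t in at_top. x t = \<psi> t $ 1" "\<forall>\<^sub>F t in at_top. z t = \<psi> t $ 3"
      using eventually_gt_at_top[of t0] by (eventually_elim, simp add: \<psi>(2) \<phi>_def)+
    then show "((\<lambda>t. \<psi> t $ 1) \<longlongrightarrow> 0) at_top" "((\<lambda>t. \<psi> t $ 3) \<longlongrightarrow> 0) at_top"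
      using lim by (blast intro: Lim_transform_eventually)+
    show "((\<lambda>t. \<psi> t $ 1) \<longlongrightarrow> sqrt b) at_bot" "((\<lambda>t. \<psi> t $ 3) \<longlongrightarrow> b) at_bot"
      using planar_backward_convergence[OF assms branch(3,4,2)] by blast+
  qed (use branch in blast)+
qed

section \<open>The four connections by symmetry\<close>

theorem mainTheorem7:
  fixes a :: real
  assumes "a < 0"
  shows "equilibria (vfield a) = insert 0 (nontrivial_equilibria a)
    \<and> card (equilibria (vfield a)) = 5
    \<and> (\<forall>p\<in>equilibria (vfield a). hyperbolic_saddle (vfield a) p)
    \<and> invariant_set (vfield a) plane_pos
    \<and> invariant_set (vfield a) plane_neg
    \<and> (\<exists>H. card H = 4
        \<and> (\<forall>p\<in>nontrivial_equilibria a. \<exists>\<gamma>\<in>H. heteroclinic_orbit (vfield a) p 0 \<gamma>)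
        \<and> (\<forall>\<gamma>\<in>H. (\<exists>p\<in>nontrivial_equilibria a. heteroclinic_orbit (vfield a) p 0 \<gamma>)
              \<and> (\<gamma> \<subseteq> plane_pos \<or> \<gamma> \<subseteq> plane_neg))
        \<and> (\<forall>T \<phi>. maximal_solution (vfield a) T \<phi> \<and> \<phi> ` T \<notin> H
              \<longrightarrow> tends_to_set T \<phi> (plane_pos \<union> plane_neg)))"
proof -
  have "- a > 0" using assms by simp
  then obtain x z :: "real \<Rightarrow> real" where
    dx: "\<forall>t. (x has_real_derivative (z t - (- a)) * x t) (at t)" and
    dz: "\<forall>t. (z has_real_derivative z t - (x t)\<^sup>2) (at t)" and pos: "\<forall>t. x t > 0" and
    lim: "(x \<longlongrightarrow> 0) at_top" "(z \<longlongrightarrow> 0) at_top" "(x \<longlongrightarrow> sqrt (-a)) at_bot" "(z \<longlongrightarrow> -a) at_bot"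
    by (rule planar_connection)
  note dx = dx[rule_format] and dz = dz[rule_format] and pos = pos[rule_format]
  \<comment> \<open>For signs r and s, the map (x, y, z) -> (r x, s r y, s z) commutes with the
    vector field; it is applied here to the connection (x, x, z).\<close>
  define \<Phi> where "\<Phi> r s t = (vector [r * x t, s * (r * x t), s * z t] :: real^3)" for r s t
  define p where "p r s = (vector [r * sqrt (-a), s * (r * sqrt (-a)), s * (-a)] :: real^3)" for r s
  define S where "S = {1, -1 :: real}"
  have S: "r = 1 \<or> r = -1" if "r \<in> S" for r using that by (simp add: S_def)
  define H where "H = (\<lambda>(r, s). range (\<Phi> r s)) ` (S \<times> S)"
  have eqs: "nontrivial_equilibria a = (\<lambda>(r, s). p r s) ` (S \<times> S)"
    by (simp add: nontrivial_equilibria_signs p_def S_def)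
  have het: "heteroclinic_orbit (vfield a) (p r s) 0 (range (\<Phi> r s))" if "r \<in> S" "s \<in> S" for r s
  proof -
    have rs: "r * r = 1" "s * s = 1" using that[THEN S] by auto
    have "(\<Phi> r s has_vector_derivative vfield a (\<Phi> r s t)) (at t)" for t
      unfolding has_vector_derivative_vec3 \<Phi>_def vector_3 vfield_nth
    proof (intro conjI)
      show "((\<lambda>t. r * x t) has_real_derivative a * (r * x t) + s * (r * x t) * (s * z t)) (at t)"
        by (rule derivative_eq_intros dx refl)+ (use rs in algebra)
      show "((\<lambda>t. s * (r * x t)) has_real_derivative a * (s * (r * x t)) + r * x t * (s * z t)) (at t)"
        by (rule derivative_eq_intros dx refl)+ (simp add: algebra_simps)
      show "((\<lambda>t. s * z t) has_real_derivative s * z t - r * x t * (s * (r * x t))) (at t)"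
        by (rule derivative_eq_intros dz refl)+ (use rs in algebra)
    qed
    then have sol: "solution_on (vfield a) UNIV (\<Phi> r s)" by (simp add: solution_on_def)
    have lim_orbit: "(\<Phi> r s \<longlongrightarrow> vector [r * c, s * (r * c), s * d]) F"
      if "(x \<longlongrightarrow> c) F" "(z \<longlongrightarrow> d) F" for c d F
    proof (rule vec_tendstoI)
      fix i :: 3
      have "((\<lambda>t. r * x t) \<longlongrightarrow> r * c) F" "((\<lambda>t. s * (r * x t)) \<longlongrightarrow> s * (r * c)) F"
        "((\<lambda>t. s * z t) \<longlongrightarrow> s * d) F"
        by (intro tendsto_mult tendsto_const that)+
      then show "((\<lambda>t. \<Phi> r s t $ i) \<longlongrightarrow> (vector [r * c, s * (r * c), s * d] :: real^3) $ i) F"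
        using exhaust_3[of i] by (elim disjE) (simp_all only: \<Phi>_def vector_3)
    qed
    have "(\<Phi> r s \<longlongrightarrow> p r s) at_bot" unfolding p_def by (rule lim_orbit[OF lim(3,4)])
    moreover have "(\<Phi> r s \<longlongrightarrow> 0) at_top"
    proof -
      have "(vector [r * 0, s * (r * 0), s * 0] :: real^3) = 0" by (simp add: vec3_eq_iff)
      then show ?thesis using lim_orbit[OF lim(1,2)] by metis
    qed
    moreover have "p r s \<in> nontrivial_equilibria a" using that eqs by blast
    moreover have "p r s \<noteq> 0" using that[THEN S] assms by (auto simp: p_def vec3_eq_iff)
    ultimately show ?thesis
      using sol unfolding heteroclinic_orbit_def equilibria_vfield[OF assms] by blast
  qed
  have plane: "range (\<Phi> r s) \<subseteq> plane_pos \<or> range (\<Phi> r s) \<subseteq> plane_neg" if "s \<in> S" for r s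
    using S[OF that] by (auto simp: plane_pos_def plane_neg_def \<Phi>_def)
  \<comment> \<open>A single common point identifies the signs: s is the quotient of its first two
    coordinates, and r is the sign of the first, because x > 0.\<close>
  have "inj_on (\<lambda>(r, s). range (\<Phi> r s)) (S \<times> S)"
  proof (rule inj_onI, clarify, intro conjI)
    fix r s r' s' :: real
    assume rs: "r \<in> S" "s \<in> S" "r' \<in> S" "s' \<in> S" and "range (\<Phi> r s) = range (\<Phi> r' s')"
    then have "\<Phi> r s 0 \<in> range (\<Phi> r' s')" by blast
    then obtain t where "\<Phi> r s 0 = \<Phi> r' s' t" by blast
    then have eq: "r * x 0 = r' * x t" "s * (r * x 0) = s' * (r' * x t)"
      unfolding \<Phi>_def vec3_eq_iff vector_3 by blast+
    have "r' * x t \<noteq> 0" using S[OF rs(3)] pos[of t] by auto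
    then show "s = s'" using eq by simp
    show "r = r'" using eq(1) S[OF rs(1)] S[OF rs(3)] pos[of 0] pos[of t] by auto
  qed
  then have "card H = card (S \<times> S)" unfolding H_def by (rule card_image)
  then have "card H = 4" by (simp only: card_cartesian_product) (simp add: S_def)
  moreover have "\<exists>\<gamma>\<in>H. heteroclinic_orbit (vfield a) e 0 \<gamma>" if e: "e \<in> nontrivial_equilibria a" for e
  proof -
    obtain r s where rs: "r \<in> S" "s \<in> S" "e = p r s" using e unfolding eqs by auto
    then have "range (\<Phi> r s) \<in> H" unfolding H_def by (intro image_eqI[of _ _ "(r, s)"]) simp_all
    then show ?thesis using het[OF rs(1,2)] rs(3) by blast
  qed
  moreover have "(\<exists>e\<in>nontrivial_equilibria a. heteroclinic_orbit (vfield a) e 0 \<gamma>)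
      \<and> (\<gamma> \<subseteq> plane_pos \<or> \<gamma> \<subseteq> plane_neg)" if \<gamma>: "\<gamma> \<in> H" for \<gamma>
  proof -
    obtain r s where rs: "r \<in> S" "s \<in> S" "\<gamma> = range (\<Phi> r s)" using \<gamma> unfolding H_def by auto
    then have "p r s \<in> nontrivial_equilibria a" unfolding eqs by (intro image_eqI[of _ _ "(r, s)"]) simp_all
    then show ?thesis using het[OF rs(1,2)] plane[OF rs(2)] rs(3) by blast
  qed
  moreover have "tends_to_set T \<phi> (plane_pos \<union> plane_neg)" if "maximal_solution (vfield a) T \<phi>" for T \<phi>
    using maximal_solution_tends_to_planes[OF that assms] .
  ultimately show ?thesis
    using equilibria_vfield[OF assms] card_equilibria_vfield[OF assms]
      hyperbolic_saddle_vfield[OF assms] invariant_planes[of a]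
    by (intro conjI exI[of _ H] ballI allI impI) blast+
qed

end
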